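(* Let $\Psi\in\mathcal C_I\cup\mathcal C_d$ and let $\Omega\subseteq S^{n-1}$ be a closed set not contained in any closed hemisphere of $S^{n-1}$. Let $f\in C^+(\Omega)$, $g\in C(\Omega)$, and for $|\varepsilon|$ sufficiently small let $f_\varepsilon\in C^+(\Omega)$ be defined by $\Psi(\xi,f_\varepsilon(\xi))=\Psi(\xi,f(\xi))+\varepsilon g(\xi)$, $\xi\in\Omega$. Then $$\lim_{\varepsilon\to0}\frac{V([f_\varepsilon])-V([f])}{\varepsilon}=\int_\Omega g(u)\,dS_\Psi([f],u),$$ where $V$ denotes volume (Lebesgue measure in $\mathbb R^n$).
   Context: $S^{n-1}$ is the unit sphere of $\mathbb R^n$, $n\ge2$, $d\xi$ spherical Lebesgue measure. $\mathscr K^n_{(o)}$: compact convex sets in $\mathbb R^n$ with the origin in their interior. For $K\in\mathscr K^n_{(o)}$: $h_K(x)=\max\{x\cdot y:y\in K\}$, $\rho_K(x)=\max\{t\ge0:tx\in K\}$; $\pmb\alpha_K(\xi)$ is the set of outer unit normals of $K$ at $\rho_K(\xi)\xi$, a singleton $\{\alpha_K(\xi)\}$ for a.e. $\xi$; $\pmb\alpha^*_K(\omega)=\{\xi:\pmb\alpha_K(\xi)\cap\omega\ne\emptyset\}$. $\mathcal C$: functions $\Psi:S^{n-1}\times(0,\infty)\to\mathbb R$ with $\Psi$, $\Psi_t=\partial\Psi/\partial t$ continuous; $\mathcal C_I=\{\Psi\in\mathcal C:\Psi_t>0\}$, $\mathcal C_d=\{\Psi\in\mathcal C:\Psi_t<0\}$.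 The Musielak–Orlicz surface area measure is $S_\Psi(K,\omega)=\int_{\pmb\alpha^*_K(\omega)}\frac{\rho_K(\xi)^n}{h_K(\alpha_K(\xi))\Psi_t(\alpha_K(\xi),h_K(\alpha_K(\xi)))}d\xi$ for Borel $\omega$. $C(\Omega)$: continuous functions on $\Omega$; $C^+(\Omega)$: strictly positive ones; $[f]=\bigcap_{\xi\in\Omega}\{x:x\cdot\xi\le f(\xi)\}$ (Wulff shape). *)

theory Defs
  imports "HOL-Analysis.Analysis"
begin

text \<open>Spherical Lebesgue measure (the (n-1)-dimensional Hausdorff measure on the
  unit sphere), given by the cone formula sigma(A) = n * vol{t x : 0 < t \<le> 1, x \<in> A}.\<close>
definition sphere_measure :: "'a::euclidean_space measure" where
  "sphere_measure = measure_of (sphere 0 1) (sets (restrict_space lborel (sphere 0 1)))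
     (\<lambda>A. of_nat DIM('a) * emeasure lebesgue {t *\<^sub>R x | t x. t \<in> {0<..1} \<and> x \<in> A})"

definition supp_fun :: "'a::euclidean_space set \<Rightarrow> 'a \<Rightarrow> real" where
  "supp_fun K x = Sup ((\<lambda>y. x \<bullet> y) ` K)"

definition radial_fun :: "'a::euclidean_space set \<Rightarrow> 'a \<Rightarrow> real" where
  "radial_fun K x = Sup {t. 0 \<le> t \<and> t *\<^sub>R x \<in> K}"

definition normals_at :: "'a::euclidean_space set \<Rightarrow> 'a \<Rightarrow> 'a set" where
  "normals_at K \<xi> = {v. norm v = 1 \<and> (\<forall>y\<in>K. v \<bullet> y \<le> v \<bullet> (radial_fun K \<xi> *\<^sub>R \<xi>))}"

text \<open>The (a.e. unique) outer unit normal; an arbitrary choice where not unique.\<close>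
definition normal_at :: "'a::euclidean_space set \<Rightarrow> 'a \<Rightarrow> 'a" where
  "normal_at K \<xi> = (SOME v. v \<in> normals_at K \<xi>)"

definition rev_radial_gauss :: "'a::euclidean_space set \<Rightarrow> 'a set \<Rightarrow> 'a set" where
  "rev_radial_gauss K \<omega> = {\<xi> \<in> sphere 0 1. normals_at K \<xi> \<inter> \<omega> \<noteq> {}}"

definition class_C :: "('a::euclidean_space \<Rightarrow> real \<Rightarrow> real) \<Rightarrow> bool" where
  "class_C Psi \<longleftrightarrow>
     continuous_on (sphere 0 1 \<times> {0<..}) (\<lambda>(\<xi>, t). Psi \<xi> t) \<and>
     (\<forall>\<xi>\<in>sphere 0 1. \<forall>t>0. Psi \<xi> differentiable (at t)) \<and>
     continuous_on (sphere 0 1 \<times> {0<..}) (\<lambda>(\<xi>, t). deriv (Psi \<xi>) t)"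

definition class_CI :: "('a::euclidean_space \<Rightarrow> real \<Rightarrow> real) \<Rightarrow> bool" where
  "class_CI Psi \<longleftrightarrow> class_C Psi \<and> (\<forall>\<xi>\<in>sphere 0 1. \<forall>t>0. deriv (Psi \<xi>) t > 0)"

definition class_Cd :: "('a::euclidean_space \<Rightarrow> real \<Rightarrow> real) \<Rightarrow> bool" where
  "class_Cd Psi \<longleftrightarrow> class_C Psi \<and> (\<forall>\<xi>\<in>sphere 0 1. \<forall>t>0. deriv (Psi \<xi>) t < 0)"

definition MO_density :: "('a::euclidean_space \<Rightarrow> real \<Rightarrow> real) \<Rightarrow> 'a set \<Rightarrow> 'a \<Rightarrow> real" where
  "MO_density Psi K \<xi> =
     radial_fun K \<xi> ^ DIM('a) /
       (supp_fun K (normal_at K \<xi>) * deriv (Psi (normal_at K \<xi>)) (supp_fun K (normal_at K \<xi>)))"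

text \<open>S_Psi(K) is a signed measure; we represent it by its positive and negative parts
  (obtained from the positive and negative parts of the density).\<close>
definition MO_area_pos :: "('a::euclidean_space \<Rightarrow> real \<Rightarrow> real) \<Rightarrow> 'a set \<Rightarrow> 'a measure" where
  "MO_area_pos Psi K = measure_of (sphere 0 1) (sets (restrict_space borel (sphere 0 1)))
     (\<lambda>\<omega>. set_nn_integral sphere_measure (rev_radial_gauss K \<omega>)
              (\<lambda>\<xi>. ennreal (MO_density Psi K \<xi>)))"

definition MO_area_neg :: "('a::euclidean_space \<Rightarrow> real \<Rightarrow> real) \<Rightarrow> 'a set \<Rightarrow> 'a measure" where
  "MO_area_neg Psi K = measure_of (sphere 0 1) (sets (restrict_space borel (sphere 0 1)))
     (\<lambda>\<omega>. set_nn_integral sphere_measure (rev_radial_gauss K \<omega>)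
              (\<lambda>\<xi>. ennreal (- MO_density Psi K \<xi>)))"

definition MO_integral ::
  "('a::euclidean_space \<Rightarrow> real \<Rightarrow> real) \<Rightarrow> 'a set \<Rightarrow> 'a set \<Rightarrow> ('a \<Rightarrow> real) \<Rightarrow> real" where
  "MO_integral Psi K \<Omega> g =
     (LINT u:\<Omega>|MO_area_pos Psi K. g u) - (LINT u:\<Omega>|MO_area_neg Psi K. g u)"

definition wulff :: "'a::euclidean_space set \<Rightarrow> ('a \<Rightarrow> real) \<Rightarrow> 'a set" where
  "wulff \<Omega> f = {x. \<forall>\<xi>\<in>\<Omega>. x \<bullet> \<xi> \<le> f \<xi>}"

text \<open>f_eps(xi) is the (unique, by strict monotonicity of Psi in t) positive solution s of
  Psi(xi, s) = Psi(xi, f(xi)) + eps g(xi).\<close>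
definition f_eps ::
  "('a::euclidean_space \<Rightarrow> real \<Rightarrow> real) \<Rightarrow> ('a \<Rightarrow> real) \<Rightarrow> ('a \<Rightarrow> real) \<Rightarrow> real \<Rightarrow> 'a \<Rightarrow> real" where
  "f_eps Psi f g \<epsilon> \<xi> = (THE s. 0 < s \<and> Psi \<xi> s = Psi \<xi> (f \<xi>) + \<epsilon> * g \<xi>)"

end

theory Submission
  imports Defs
begin

text \<open>The gauge of the Wulff shape is \<open>p(x) = max\<^bsub>\<xi>\<in>\<Omega>\<^esub> (x \<bullet> \<xi>) / f(\<xi>)\<close>, its radial function on
  the sphere is \<open>1/p\<close>, and the volume is \<open>1/n\<close> times the spherical integral of \<open>(1/p)\<^sup>n\<close>. If \<open>\<xi>\<close>
  attains the maximum at \<open>x\<close>, then \<open>\<xi>\<close> is an outer normal at the boundary point in direction \<open>x\<close>. Two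
  normals there yield two subgradients of \<open>p\<close> at \<open>x\<close>, which happens only on a null set, because along a
  line the subgradients of a function jump at most countably often. Where the maximizer is unique,
  Danskin's argument gives the derivative of the gauge of \<open>[f\<^sub>\<epsilon>]\<close> in \<open>\<epsilon>\<close>, and dominated convergence
  gives the derivative of the volume.\<close>

subsection \<open>Points with several subgradients\<close>

text \<open>Where several points attain the maximum, the gauge of the perturbed shape has in general
  only one-sided derivatives in \<epsilon>, so the two-sided limit rests on almost everywhere
  uniqueness. At a unique maximizer z the gauge changes at the rate \<open>- p D / f\<close>, where
  \<open>D = g / Psi_t\<close> is the derivative of \<open>f_eps\<close> in \<epsilon>, and
  \<open>(1/p)^n\<close> at the rate \<open>n (1/p)^n D / f\<close>. The factor n cancels the 1/n of
  the volume formula, and \<open>h_K z = f z\<close> turns the rest into the density of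
  \<open>S_Psi\<close> times g. A second obstacle is that \<open>normal_at\<close> is an arbitrary
  choice at singular points and need not be measurable there. The integrals are therefore computed
  with \<open>contact\<close>, a Borel map into \<Omega> that agrees with it outside a null set of
  the sphere; null sets pass from space to the sphere because the kinks of a gauge are invariant
  under positive scaling. For decreasing \<open>Psi\<close> the pair \<open>(- Psi, - g)\<close>
  defines the same \<open>f_eps\<close>, so only the increasing case is computed.\<close>

definition subgradients :: "('a::euclidean_space \<Rightarrow> real) \<Rightarrow> 'a \<Rightarrow> 'a set" where
  "subgradients p x = {w. \<forall>y. p x + w \<bullet> (y - x) \<le> p y}"

text \<open>Testing at \<open>x + w\<close> turns the subgradient inequality into
  \<open>|w|^2 \<le> L |w|\<close>. The bound confines subgradients to a compact ball, from which
  the measurability of the kinks follows.\<close>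

lemma norm_subgradient_le:
  assumes "L-lipschitz_on UNIV p" and "w \<in> subgradients p x"
  shows "norm w \<le> L"
proof -
  have "p x + w \<bullet> (x + w - x) \<le> p (x + w)"
    using assms(2) unfolding subgradients_def by blast
  moreover have "\<bar>p (x + w) - p x\<bar> \<le> L * norm w"
    using lipschitz_onD[OF assms(1), of "x + w" x] by (simp add: dist_norm)
  ultimately have "norm w * norm w \<le> L * norm w"
    by (simp add: dot_square_norm power2_eq_square)
  then show ?thesis
    using lipschitz_on_nonneg[OF assms(1)] by (cases "norm w = 0") auto
qed

text \<open>Each inequality is tested at the base point of the other; in the sum the values of
  \<open>p\<close> cancel.\<close>

lemma subgradients_line_mono:
  assumes "v \<in> subgradients p (x + s *\<^sub>R i)" and "w \<in> subgradients p (x + t *\<^sub>R i)" and "s < t"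
  shows "v \<bullet> i \<le> w \<bullet> i"
proof -
  have "p (x + s *\<^sub>R i) + v \<bullet> ((x + t *\<^sub>R i) - (x + s *\<^sub>R i)) \<le> p (x + t *\<^sub>R i)"
    and "p (x + t *\<^sub>R i) + w \<bullet> ((x + s *\<^sub>R i) - (x + t *\<^sub>R i)) \<le> p (x + s *\<^sub>R i)"
    using assms(1,2) unfolding subgradients_def by blast+
  then have "(t - s) * (v \<bullet> i) \<le> (t - s) * (w \<bullet> i)"
    by (simp add: algebra_simps)
  then show ?thesis
    using \<open>s < t\<close> by simp
qed

text \<open>By monotonicity the slope intervals at different parameters \<open>t\<close> do not
  overlap, so each jump owns a rational of its own.\<close>

lemma countable_subgradients_jump:
  "countable {t. \<exists>v\<in>subgradients p (x + t *\<^sub>R i). \<exists>w\<in>subgradients p (x + t *\<^sub>R i). v \<bullet> i < w \<bullet> i}"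
    (is "countable ?T")
proof -
  define P where "P t q \<longleftrightarrow> q \<in> \<rat> \<and> (\<exists>v\<in>subgradients p (x + t *\<^sub>R i).
      \<exists>w\<in>subgradients p (x + t *\<^sub>R i). v \<bullet> i < q \<and> q < w \<bullet> i)" for t q
  define q where "q t = (SOME q. P t q)" for t
  have "P t (q t)" if "t \<in> ?T" for t
  proof -
    obtain v w where "v \<in> subgradients p (x + t *\<^sub>R i)" "w \<in> subgradients p (x + t *\<^sub>R i)"
      and "v \<bullet> i < w \<bullet> i"
      using \<open>t \<in> ?T\<close> by blast
    moreover obtain r where "r \<in> \<rat>" "v \<bullet> i < r" "r < w \<bullet> i"
      using Rats_dense_in_real[OF \<open>v \<bullet> i < w \<bullet> i\<close>] by blast
    ultimately have "P t r"
      unfolding P_def by blast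
    then show ?thesis
      unfolding q_def by (rule someI)
  qed
  note q = this[unfolded P_def]
  have less: "q s < q t" if st: "s \<in> ?T" "t \<in> ?T" "s < t" for s t
  proof -
    obtain v where "v \<in> subgradients p (x + s *\<^sub>R i)" "q s < v \<bullet> i"
      using q[OF st(1)] by blast
    moreover obtain w where "w \<in> subgradients p (x + t *\<^sub>R i)" "w \<bullet> i < q t"
      using q[OF st(2)] by blast
    ultimately show ?thesis
      using subgradients_line_mono[of v p x s i w t] \<open>s < t\<close> by simp
  qed
  have "inj_on q ?T"
  proof (rule inj_onI)
    fix s t assume "s \<in> ?T" "t \<in> ?T" "q s = q t"
    then show "s = t"
      using less[of s t] less[of t s] by (cases s t rule: linorder_cases) auto
  qed
  moreover have "q ` ?T \<subseteq> \<rat>"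
    using q by blast
  then have "countable (q ` ?T)"
    using countable_rat countable_subset by blast
  ultimately show ?thesis
    by (rule countable_image_inj_on[rotated])
qed

text \<open>Tonelli for \<open>(x, t) \<mapsto> x + t i\<close>, using translation invariance in place of a splitting of
  the space into the line and its orthogonal complement.\<close>
lemma null_set_if_countable_on_lines:
  fixes E :: "'a::euclidean_space set"
  assumes E [measurable]: "E \<in> sets borel" and cnt: "\<And>x. countable {t. x + t *\<^sub>R i \<in> E}"
  shows "E \<in> null_sets lborel"
proof -
  \<comment> \<open>The cutoff gives the line direction length one, so integrating in the other
    order returns the measure of \<open>E\<close> itself.\<close>
  let ?f = "\<lambda>(x, t::real). indicator E (x + t *\<^sub>R i) * indicator {0..1} t :: ennreal"
  have "(\<integral>\<^sup>+ x. (\<integral>\<^sup>+ t. ?f (x, t) \<partial>lborel) \<partial>lborel) = (\<integral>\<^sup>+ x. 0 \<partial>(lborel :: 'a measure))"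
  proof (intro nn_integral_cong)
    fix x :: 'a
    have "AE t in lborel. t \<notin> {t. x + t *\<^sub>R i \<in> E}"
      by (intro AE_not_in countable_imp_null_set_lborel cnt)
    then have "AE t in lborel. ?f (x, t) = 0"
      by eventually_elim simp
    then show "(\<integral>\<^sup>+ t. ?f (x, t) \<partial>lborel) = 0"
      by (subst nn_integral_cong_AE[of _ "\<lambda>_. 0"]) auto
  qed
  moreover have "(\<integral>\<^sup>+ t. (\<integral>\<^sup>+ x. ?f (x, t) \<partial>lborel) \<partial>lborel) =
    (\<integral>\<^sup>+ x. (\<integral>\<^sup>+ t. ?f (x, t) \<partial>lborel) \<partial>lborel)"
    by (rule lborel_pair.Fubini) measurable
  \<comment> \<open>For fixed \<open>t\<close> the slice is a translate of \<open>E\<close>.\<close>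
  moreover have "(\<integral>\<^sup>+ x. ?f (x, t) \<partial>lborel) = emeasure lborel E * indicator {0..1} t" for t
  proof -
    have "(\<integral>\<^sup>+ x. ?f (x, t) \<partial>lborel) = (\<integral>\<^sup>+ x. indicator E (t *\<^sub>R i + x) \<partial>lborel) * indicator {0..1} t"
      by (simp add: nn_integral_multc add.commute)
    also have "(\<integral>\<^sup>+ x. indicator E (t *\<^sub>R i + x) \<partial>lborel) =
        (\<integral>\<^sup>+ x. indicator E x \<partial>distr lborel borel ((+) (t *\<^sub>R i)))"
      by (rule nn_integral_distr[symmetric]) measurable
    also have "\<dots> = emeasure lborel E"
      by (simp add: lborel_distr_plus)
    finally show ?thesis .
  qed
  ultimately have "emeasure lborel E = 0"
    by (simp add: nn_integral_cmult)
  then show ?thesis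
    by auto
qed

text \<open>For a convex function these are the points of non-differentiability.\<close>

definition kinks :: "('a::euclidean_space \<Rightarrow> real) \<Rightarrow> 'a set" where
  "kinks p = {x. \<exists>v\<in>subgradients p x. \<exists>w\<in>subgradients p x. v \<noteq> w}"

text \<open>Two distinct subgradients differ in some coordinate by at least
  \<open>1 / Suc k\<close>, so the kinks are a countable union of sets \<open>E i k\<close>, each of
  which meets every line parallel to \<open>i\<close> in a countable set.\<close>

lemma null_sets_kinks:
  fixes p :: "'a::euclidean_space \<Rightarrow> real"
  assumes "L-lipschitz_on UNIV p"
  shows "kinks p \<in> null_sets lborel"
proof -
  \<comment> \<open>The fixed gap makes the condition on the pair of subgradients closed, and the
    pair ranges over a compact set. Hence \<open>E i k\<close>, a projection along a compact factor,
    is closed and in particular Borel.\<close>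
  define E where "E i k = {x. \<exists>z. z \<in> cball 0 L \<times> cball 0 L \<and>
      (z, x) \<in> {(z, x). fst z \<in> subgradients p x \<and> snd z \<in> subgradients p x \<and>
        snd z \<bullet> i - fst z \<bullet> i \<ge> 1 / Suc k}}" for i :: 'a and k :: nat
  have p: "continuous_on UNIV p"
    using assms lipschitz_on_continuous_on by blast
  have p': "continuous_on A (\<lambda>x. p (h x))" if "continuous_on A h" for A :: "'b::topological_space set" and h
    by (rule continuous_on_compose2[OF p that]) auto
  have "closed (E i k)" for i k
  proof -
    have "closed {u. (\<forall>y. p (snd u) + fst (fst u) \<bullet> (y - snd u) \<le> p y) \<and>
        (\<forall>y. p (snd u) + snd (fst u) \<bullet> (y - snd u) \<le> p y) \<and>
        1 / Suc k \<le> snd (fst u) \<bullet> i - fst (fst u) \<bullet> i}"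
      by (intro closed_Collect_conj closed_Collect_all closed_Collect_le p' continuous_intros)
    from closed_compact_projection[OF compact_Times[OF compact_cball compact_cball] this, of 0 L 0 L]
    show ?thesis
      unfolding E_def subgradients_def by simp
  qed
  then have E: "E i k \<in> sets borel" for i k
    by auto
  have "E i k \<in> null_sets lborel" for i k
  proof (rule null_set_if_countable_on_lines[OF E])
    fix x
    show "countable {t. x + t *\<^sub>R i \<in> E i k}"
    proof (rule countable_subset[OF _ countable_subgradients_jump[of p x i]], clarify)
      fix t
      assume "x + t *\<^sub>R i \<in> E i k"
      then obtain v w where "v \<in> subgradients p (x + t *\<^sub>R i)" "w \<in> subgradients p (x + t *\<^sub>R i)"
        and vw: "w \<bullet> i - v \<bullet> i \<ge> 1 / Suc k"
        unfolding E_def by auto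
      moreover have "v \<bullet> i < w \<bullet> i"
        using vw by (smt (verit) divide_pos_pos of_nat_0_less_iff zero_less_Suc)
      ultimately show "\<exists>v\<in>subgradients p (x + t *\<^sub>R i). \<exists>w\<in>subgradients p (x + t *\<^sub>R i). v \<bullet> i < w \<bullet> i"
        by blast
    qed
  qed
  then have "(\<Union>i\<in>Basis. \<Union>k. E i k) \<in> null_sets lborel"
    by (intro null_sets_UN' countableI_type countable_finite[OF finite_Basis])
  moreover have "kinks p = (\<Union>i\<in>Basis. \<Union>k. E i k)"
  proof (intro equalityI subsetI)
    fix x assume "x \<in> kinks p"
    then obtain v w where vw: "v \<in> subgradients p x" "w \<in> subgradients p x" "v \<noteq> w"
      unfolding kinks_def by auto
    then obtain i where i: "i \<in> Basis" "v \<bullet> i \<noteq> w \<bullet> i"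
      using euclidean_eqI by blast
    have "\<exists>v\<in>subgradients p x. \<exists>w\<in>subgradients p x. v \<bullet> i < w \<bullet> i"
      using vw i by (metis neqE)
    then obtain v w where *: "v \<in> subgradients p x" "w \<in> subgradients p x" "w \<bullet> i - v \<bullet> i > 0"
      by auto
    then obtain k where "inverse (Suc k) < w \<bullet> i - v \<bullet> i"
      using reals_Archimedean by blast
    then have "x \<in> E i k"
      using * norm_subgradient_le[OF assms]
      unfolding E_def inverse_eq_divide by (intro CollectI exI[of _ "(v, w)"]) simp
    then show "x \<in> (\<Union>i\<in>Basis. \<Union>k. E i k)"
      using i by blast
  next
    fix x assume "x \<in> (\<Union>i\<in>Basis. \<Union>k. E i k)"
    then obtain i k v w where "v \<in> subgradients p x" "w \<in> subgradients p x"
      and vw: "w \<bullet> i - v \<bullet> i \<ge> 1 / Suc k"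
      unfolding E_def by auto
    moreover have "v \<noteq> w"
      using vw by (auto simp: divide_le_0_iff)
    ultimately show "x \<in> kinks p"
      unfolding kinks_def by blast
  qed
  ultimately show ?thesis
    by simp
qed

subsection \<open>Spherical measure and polar coordinates\<close>

lemma sgn_measurable_punctured:
  "sgn \<in> measurable (restrict_space lborel (cball 0 1 - {0})) (restrict_space borel (sphere (0::'a::euclidean_space) 1))"
proof (rule measurable_restrict_space2)
  show "sgn \<in> space (restrict_space lborel (cball 0 1 - {0})) \<rightarrow> sphere (0::'a) 1"
    by (auto simp: space_restrict_space norm_sgn)
  show "sgn \<in> measurable (restrict_space lborel (cball 0 1 - {0})) (borel :: 'a measure)"
    by (intro measurable_restrict_space1) (simp add: sgn_div_norm)
qed

lemma cone_eq:
  assumes "A \<subseteq> sphere (0::'a::euclidean_space) 1"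
  shows "{t *\<^sub>R x | t x. t \<in> {0<..1} \<and> x \<in> A} = {x. 0 < norm x \<and> norm x \<le> 1 \<and> sgn x \<in> A}"
proof (intro equalityI subsetI)
  fix y assume "y \<in> {t *\<^sub>R x | t x. t \<in> {0<..1} \<and> x \<in> A}"
  then obtain t x where "y = t *\<^sub>R x" "0 < t" "t \<le> 1" "x \<in> A"
    by auto
  moreover then have "norm x = 1" "sgn x = x"
    using assms by (auto simp: sgn_div_norm)
  ultimately show "y \<in> {x. 0 < norm x \<and> norm x \<le> 1 \<and> sgn x \<in> A}"
    by (auto simp: sgn_scaleR)
next
  fix y assume y: "y \<in> {x. 0 < norm x \<and> norm x \<le> 1 \<and> sgn x \<in> A}"
  then have "y = norm y *\<^sub>R sgn y"
    by (simp add: sgn_div_norm)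
  with y show "y \<in> {t *\<^sub>R x | t x. t \<in> {0<..1} \<and> x \<in> A}"
    by (intro CollectI exI[of _ "norm y"] exI[of _ "sgn y"]) simp
qed

lemma cone_in_borel:
  assumes "A \<in> sets borel"
  shows "{x::'a::euclidean_space. 0 < norm x \<and> norm x \<le> 1 \<and> sgn x \<in> A} \<in> sets borel"
proof -
  have [measurable]: "sgn \<in> borel_measurable (borel :: 'a measure)" "A \<in> sets borel"
    using assms by (simp_all add: sgn_div_norm)
  show ?thesis
    by measurable
qed

text \<open>\<open>measure_of\<close> returns the zero measure unless the given set function is a
  measure. A push-forward is one by construction, and the cone over \<open>A\<close> is the preimage
  of \<open>A\<close> under \<open>sgn\<close> in the punctured ball, so additivity of the cone
  formula comes for free.\<close>

lemma sphere_measure_eq_distr: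
  "(sphere_measure :: 'a::euclidean_space measure) =
     distr (density (restrict_space lborel (cball 0 1 - {0})) (\<lambda>_. DIM('a)))
       (restrict_space borel (sphere 0 1)) sgn" (is "_ = distr ?M ?N sgn")
proof -
  have "of_nat DIM('a) * emeasure lebesgue {t *\<^sub>R x | t x. t \<in> {0<..1} \<and> x \<in> A} =
      emeasure ?M (sgn -` A \<inter> space ?M)"
    if "A \<in> sigma_sets (sphere 0 1) (sets ?N)" for A
  proof -
    have A: "A \<in> sets ?N"
      using that sets.sigma_sets_eq[of ?N] by (simp add: space_restrict_space)
    then have A': "A \<subseteq> sphere 0 1" "A \<in> sets borel"
      using sets.sets_into_space[OF A] by (auto simp: space_restrict_space sets_restrict_space_iff)
    have eq: "sgn -` A \<inter> space ?M = {x. 0 < norm x \<and> norm x \<le> 1 \<and> sgn x \<in> A}"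
      by (auto simp: space_restrict_space)
    have cone: "{x. 0 < norm x \<and> norm x \<le> 1 \<and> sgn x \<in> A} \<in> sets borel"
      by (rule cone_in_borel) fact
    have "sgn -` A \<inter> space ?M \<in> sets (restrict_space lborel (cball 0 1 - {0::'a}))"
      using measurable_sets[OF sgn_measurable_punctured A] by (simp add: space_restrict_space)
    then have "emeasure ?M (sgn -` A \<inter> space ?M) =
        of_nat DIM('a) * emeasure (restrict_space lborel (cball 0 1 - {0})) (sgn -` A \<inter> space ?M)"
      by (simp add: emeasure_density nn_integral_cmult)
    also have "\<dots> = of_nat DIM('a) * emeasure lborel (sgn -` A \<inter> space ?M)"
      by (subst emeasure_restrict_space) (auto simp: space_restrict_space)
    moreover have "emeasure lebesgue {x. 0 < norm x \<and> norm x \<le> 1 \<and> sgn x \<in> A} =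
        emeasure lborel {x. 0 < norm x \<and> norm x \<le> 1 \<and> sgn x \<in> A}"
      using cone by simp
    ultimately show ?thesis
      by (simp only: eq cone_eq[OF A'(1)])
  qed
  then have "measure_of (sphere 0 1) (sets ?N) (\<lambda>A. of_nat DIM('a) * emeasure lebesgue {t *\<^sub>R x | t x. t \<in> {0<..1} \<and> x \<in> A})
    = measure_of (sphere 0 1) (sets ?N) (\<lambda>A. emeasure ?M (sgn -` A \<inter> space ?M))"
    using sets.space_closed[of ?N] by (intro measure_of_eq) (simp_all add: space_restrict_space)
  then show ?thesis
    unfolding sphere_measure_def distr_def by (simp add: space_restrict_space sets_restrict_space)
qed

lemma sets_sphere_measure [simp, measurable_cong]:
  "sets (sphere_measure :: 'a::euclidean_space measure) = sets (restrict_space borel (sphere 0 1))"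
  unfolding sphere_measure_eq_distr by simp

lemma space_sphere_measure [simp]: "space (sphere_measure :: 'a::euclidean_space measure) = sphere 0 1"
  unfolding sphere_measure_eq_distr by (simp add: space_restrict_space)

lemma emeasure_sphere_measure:
  fixes A :: "'a::euclidean_space set"
  assumes "A \<in> sets sphere_measure"
  shows "emeasure sphere_measure A = DIM('a) * emeasure lborel {x. 0 < norm x \<and> norm x \<le> 1 \<and> sgn x \<in> A}"
proof -
  let ?R = "restrict_space lborel (cball 0 1 - {0::'a})"
  have A: "A \<in> sets (restrict_space borel (sphere 0 1))"
    using assms by simp
  have eq: "sgn -` A \<inter> space ?R = {x. 0 < norm x \<and> norm x \<le> 1 \<and> sgn x \<in> A}"
    by (auto simp: space_restrict_space)
  have "emeasure sphere_measure A = emeasure (density ?R (\<lambda>_. DIM('a))) (sgn -` A \<inter> space ?R)"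
    unfolding sphere_measure_eq_distr using sgn_measurable_punctured A by (subst emeasure_distr) auto
  also have "\<dots> = of_nat DIM('a) * emeasure ?R (sgn -` A \<inter> space ?R)"
    using measurable_sets[OF sgn_measurable_punctured A] by (simp add: emeasure_density nn_integral_cmult)
  also have "\<dots> = of_nat DIM('a) * emeasure lborel (sgn -` A \<inter> space ?R)"
    by (subst emeasure_restrict_space) (auto simp: space_restrict_space)
  finally show ?thesis
    by (simp only: eq)
qed

lemma finite_measure_sphere_measure: "finite_measure (sphere_measure :: 'a::euclidean_space measure)"
proof (rule finite_measureI)
  have "emeasure (sphere_measure :: 'a measure) (sphere 0 1) \<le> DIM('a) * emeasure lborel (cball 0 1 :: 'a set)"
    by (subst emeasure_sphere_measure) (auto intro!: mult_left_mono emeasure_mono simp: sets_restrict_space_iff)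
  also have "\<dots> < \<infinity>"
    using emeasure_lborel_cball_finite[of "0::'a" 1] by (simp add: ennreal_mult_less_top of_nat_less_top)
  finally show "emeasure (sphere_measure :: 'a measure) (space sphere_measure) \<noteq> \<infinity>"
    by simp
qed

lemma emeasure_lborel_scaleR:
  fixes A :: "'a::euclidean_space set"
  assumes "c > 0" and [measurable]: "A \<in> sets borel"
  shows "emeasure lborel {x. x /\<^sub>R c \<in> A} = ennreal c ^ DIM('a) * emeasure lborel A"
proof -
  have eq: "{x. x /\<^sub>R c \<in> A} = (\<lambda>x. c *\<^sub>R x + 0) ` A"
    using assms(1) by (force simp: image_iff)
  have "{x. x /\<^sub>R c \<in> A} \<in> sets borel"
    by measurable
  then show ?thesis
    using emeasure_lebesgue_affine[of c 0 A] assms(1) unfolding eq[symmetric] by (simp add: ennreal_power)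
qed

text \<open>Each product \<open>u i * u j ^ n\<close> is dominated by the one at the common index
  \<open>max i j\<close>, so the double supremum collapses to the diagonal.\<close>

lemma SUP_power_ennreal:
  fixes u :: "nat \<Rightarrow> ennreal"
  assumes "incseq u"
  shows "(SUP i. u i) ^ n = (SUP i. u i ^ n)"
proof (induction n)
  case (Suc n)
  have "u i * u j ^ n \<le> (SUP k. u k * u k ^ n)" for i j
    using incseqD[OF assms, of i "max i j"] incseqD[OF assms, of j "max i j"]
    by (intro SUP_upper2[of "max i j"]) (auto intro!: mult_mono power_mono)
  then have "(SUP i. u i) * (SUP j. u j ^ n) \<le> (SUP k. u k * u k ^ n)"
    by (simp add: SUP_mult_right_ennreal SUP_mult_left_ennreal SUP_le_iff)
  moreover have "(SUP k. u k * u k ^ n) \<le> (SUP i. u i) * (SUP j. u j ^ n)"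
    by (intro SUP_least mult_mono SUP_upper) auto
  ultimately show ?case
    by (simp add: Suc)
qed simp

text \<open>Polar coordinates, read as the volume of the star-shaped region with radial function
  \<open>u\<close>. Induction over measurable functions works because both sides scale with
  \<open>c ^ n\<close>, add up over disjoint supports and respect increasing limits; indicators are
  the cone formula.\<close>

theorem nn_integral_sphere_power:
  fixes u :: "'a::euclidean_space \<Rightarrow> ennreal"
  assumes "u \<in> borel_measurable sphere_measure"
  shows "(\<integral>\<^sup>+ \<xi>. u \<xi> ^ DIM('a) \<partial>sphere_measure) =
    DIM('a) * emeasure lborel {x. x \<noteq> 0 \<and> ennreal (norm x) < u (sgn x)}"
proof -
  let ?S = "restrict_space borel (sphere (0::'a) 1)"
  have sgn [measurable]: "sgn \<in> measurable (restrict_space borel (-{0})) ?S"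
    by (rule measurable_restrict_space2)
      (auto simp: space_restrict_space norm_sgn sgn_div_norm intro!: measurable_restrict_space1)
  have meas: "{x. x \<noteq> 0 \<and> ennreal (norm x) < v (sgn x)} \<in> sets borel"
    if v [measurable]: "v \<in> borel_measurable sphere_measure" for v :: "'a \<Rightarrow> ennreal"
  proof -
    have "v \<in> borel_measurable ?S"
      using v by (simp cong: measurable_cong_sets)
    then have [measurable]: "(\<lambda>x. v (sgn x)) \<in> borel_measurable (restrict_space borel (-{0}))"
      using sgn by (rule measurable_compose[rotated])
    have [measurable]: "(\<lambda>x. ennreal (norm x)) \<in> borel_measurable (restrict_space borel (-{0::'a}))"
      by (intro measurable_restrict_space1) simp
    have "{x \<in> space (restrict_space borel (-{0})). ennreal (norm x) < v (sgn x)} \<in> sets (restrict_space borel (-{0}))"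
      by measurable
    then show ?thesis
      by (simp add: sets_restrict_space_iff space_restrict_space Collect_conj_eq Compl_eq)
  qed
  from assms show ?thesis
  proof (induction rule: borel_measurable_induct)
    case (cong f g)
    have "{x. x \<noteq> 0 \<and> ennreal (norm x) < f (sgn x)} = {x. x \<noteq> 0 \<and> ennreal (norm x) < g (sgn x)}"
      using cong(3) by (auto simp: norm_sgn)
    moreover have "(\<integral>\<^sup>+ \<xi>. f \<xi> ^ DIM('a) \<partial>sphere_measure) = (\<integral>\<^sup>+ \<xi>. g \<xi> ^ DIM('a) \<partial>sphere_measure)"
      using cong(3) by (intro nn_integral_cong) simp
    ultimately show ?case
      using cong(4) by simp
  next
    case (set A)
    have A: "A \<in> sets borel"
      using set by (simp add: sets_restrict_space_iff)
    have "(\<integral>\<^sup>+ \<xi>. indicator A \<xi> ^ DIM('a) \<partial>sphere_measure) = (\<integral>\<^sup>+ \<xi>. indicator A \<xi> \<partial>sphere_measure)"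
      by (intro nn_integral_cong) (auto simp: indicator_def)
    also have "\<dots> = emeasure sphere_measure A"
      using set by simp
    also have "\<dots> = DIM('a) * emeasure lborel {x. 0 < norm x \<and> norm x \<le> 1 \<and> sgn x \<in> A}"
      by (rule emeasure_sphere_measure) fact
    also have "emeasure lborel {x. 0 < norm x \<and> norm x \<le> 1 \<and> sgn x \<in> A} =
      emeasure lborel {x. x \<noteq> 0 \<and> ennreal (norm x) < indicator A (sgn x)}"
    \<comment> \<open>The cone includes points of norm one, the strict inequality excludes them; the
      sphere is a null set.\<close>
    proof (rule emeasure_eq_AE)
      have "sphere (0::'a) 1 \<in> null_sets lborel"
        using negligible_convex_frontier[of "cball (0::'a) 1"]
        by (auto simp: null_sets_completion_iff negligible_iff_null_sets)
      then have "AE x in lborel. x \<notin> sphere (0::'a) 1"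
        by (rule AE_not_in)
      then show "AE x in lborel. (x \<in> {x. 0 < norm x \<and> norm x \<le> 1 \<and> sgn x \<in> A}) =
        (x \<in> {x. x \<noteq> 0 \<and> ennreal (norm x) < indicator A (sgn x)})"
        by eventually_elim (auto simp: indicator_def)
    qed (use cone_in_borel[OF A] meas[of "indicator A"] set in auto)
    finally show ?case .
  next
    case (mult u c)
    show ?case
    proof (cases "c = 0")
      case False
      then obtain r where r: "c = ennreal r" "r > 0"
        using mult(1) by (cases c) auto
      have "ennreal (norm x) < c * u (sgn x) \<longleftrightarrow> ennreal (norm (x /\<^sub>R r)) < u (sgn (x /\<^sub>R r))" for x
      proof -
        have "ennreal (norm x) = ennreal r * ennreal (norm (x /\<^sub>R r))"
          using r by (simp add: ennreal_mult'[symmetric] field_simps)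
        moreover have "sgn (x /\<^sub>R r) = sgn x"
          using r by (simp add: sgn_scaleR)
        ultimately show ?thesis
          using r ennreal_mult_le_mult_iff[of c "u (sgn x)" "ennreal (norm (x /\<^sub>R r))"]
          by (simp add: not_le[symmetric])
      qed
      then have eq: "{x. x \<noteq> 0 \<and> ennreal (norm x) < c * u (sgn x)} =
          {x. x /\<^sub>R r \<in> {x. x \<noteq> 0 \<and> ennreal (norm x) < u (sgn x)}}"
        using r by auto
      have "(\<integral>\<^sup>+ \<xi>. (c * u \<xi>) ^ DIM('a) \<partial>sphere_measure) = c ^ DIM('a) * (\<integral>\<^sup>+ \<xi>. u \<xi> ^ DIM('a) \<partial>sphere_measure)"
        using mult(2) by (simp add: power_mult_distrib nn_integral_cmult)
      then show ?thesis
        unfolding eq emeasure_lborel_scaleR[OF r(2) meas[OF mult(2)]] mult.IH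
        by (simp add: r ac_simps)
    qed (simp add: zero_power)
  next
    case (add u v)
    \<comment> \<open>The summands of the induction rule have disjoint supports. This splits the
      n-th power of the sum and makes the regions disjoint.\<close>
    have disj: "u (sgn x) = 0 \<or> v (sgn x) = 0" if "x \<noteq> 0" for x
      using that by (intro add(5)) (simp add: norm_sgn)
    have "(\<integral>\<^sup>+ \<xi>. (v \<xi> + u \<xi>) ^ DIM('a) \<partial>sphere_measure) =
      (\<integral>\<^sup>+ \<xi>. v \<xi> ^ DIM('a) + u \<xi> ^ DIM('a) \<partial>sphere_measure)"
      using add by (intro nn_integral_cong) (force simp: zero_power)
    also have "\<dots> = (\<integral>\<^sup>+ \<xi>. v \<xi> ^ DIM('a) \<partial>sphere_measure) + (\<integral>\<^sup>+ \<xi>. u \<xi> ^ DIM('a) \<partial>sphere_measure)"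
      using add by (intro nn_integral_add) auto
    also have "\<dots> = DIM('a) * (emeasure lborel {x. x \<noteq> 0 \<and> ennreal (norm x) < v (sgn x)}
        + emeasure lborel {x. x \<noteq> 0 \<and> ennreal (norm x) < u (sgn x)})"
      using add by (simp add: distrib_left)
    also have "emeasure lborel {x. x \<noteq> 0 \<and> ennreal (norm x) < v (sgn x)}
        + emeasure lborel {x. x \<noteq> 0 \<and> ennreal (norm x) < u (sgn x)} =
      emeasure lborel ({x. x \<noteq> 0 \<and> ennreal (norm x) < v (sgn x)} \<union> {x. x \<noteq> 0 \<and> ennreal (norm x) < u (sgn x)})"
    proof (rule plus_emeasure)
      show "{x. x \<noteq> 0 \<and> ennreal (norm x) < v (sgn x)} \<inter> {x. x \<noteq> 0 \<and> ennreal (norm x) < u (sgn x)} = {}"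
        using disj by force
    qed (use meas add in auto)
    also have "{x. x \<noteq> 0 \<and> ennreal (norm x) < v (sgn x)} \<union> {x. x \<noteq> 0 \<and> ennreal (norm x) < u (sgn x)} =
      {x. x \<noteq> 0 \<and> ennreal (norm x) < v (sgn x) + u (sgn x)}"
      using disj by force
    finally show ?case .
  next
    case (seq U)
    have U: "incseq (\<lambda>i. U i \<xi>)" for \<xi>
      using seq(3) by (auto simp: incseq_def le_fun_def)
    have "(\<integral>\<^sup>+ \<xi>. (SUP i. U i) \<xi> ^ DIM('a) \<partial>sphere_measure) = (\<integral>\<^sup>+ \<xi>. (SUP i. U i \<xi> ^ DIM('a)) \<partial>sphere_measure)"
      using SUP_power_ennreal[OF U] by (simp add: image_comp)
    also have "\<dots> = (SUP i. (\<integral>\<^sup>+ \<xi>. U i \<xi> ^ DIM('a) \<partial>sphere_measure))"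
      using seq(1) U by (intro nn_integral_monotone_convergence_SUP)
        (auto simp: incseq_def le_fun_def intro!: power_mono)
    also have "\<dots> = DIM('a) * (SUP i. emeasure lborel {x. x \<noteq> 0 \<and> ennreal (norm x) < U i (sgn x)})"
      by (simp add: seq.IH SUP_mult_left_ennreal)
    also have "(SUP i. emeasure lborel {x. x \<noteq> 0 \<and> ennreal (norm x) < U i (sgn x)}) =
      emeasure lborel (\<Union>i. {x. x \<noteq> 0 \<and> ennreal (norm x) < U i (sgn x)})"
      using meas seq(1) U by (intro SUP_emeasure_incseq) (auto simp: incseq_def intro: less_le_trans)
    also have "(\<Union>i. {x. x \<noteq> 0 \<and> ennreal (norm x) < U i (sgn x)}) =
      {x. x \<noteq> 0 \<and> ennreal (norm x) < (SUP i. U i) (sgn x)}"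
      by (auto simp: less_SUP_iff image_comp)
    finally show ?case .
  qed
qed

subsection \<open>Integrals against the surface area measure\<close>

text \<open>Neither \<open>d\<close> nor the sets \<open>rev_radial_gauss K \<omega>\<close> need be measurable. This is harmless: the
  nonnegative integral does not change when an arbitrary integrand is modified on a null set.\<close>
lemma integral_normal_pushforward:
  fixes K :: "'a::euclidean_space set"
  defines "S \<equiv> restrict_space borel (sphere (0::'a) 1)"
  assumes A [measurable]: "A \<in> measurable sphere_measure S"
    and D [measurable]: "D \<in> borel_measurable sphere_measure"
    and N: "N \<in> null_sets sphere_measure"
    and eq: "\<And>\<xi>. \<xi> \<in> sphere 0 1 - N \<Longrightarrow> normals_at K \<xi> = {A \<xi>} \<and> d \<xi> = D \<xi>"
    and G [measurable]: "G \<in> borel_measurable S"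
  shows "(\<integral>u. G u \<partial>measure_of (sphere 0 1) (sets S)
      (\<lambda>\<omega>. set_nn_integral sphere_measure (rev_radial_gauss K \<omega>) (\<lambda>\<xi>. ennreal (d \<xi>)))) =
    (\<integral>\<xi>. max 0 (D \<xi>) * G (A \<xi>) \<partial>sphere_measure)" (is "integral\<^sup>L ?M G = _")
proof -
  let ?m = "density sphere_measure (\<lambda>\<xi>. ennreal (max 0 (D \<xi>)))"
  have A' [measurable]: "A \<in> measurable ?m S"
    by simp
  \<comment> \<open>Outside \<open>N\<close>, lying in \<open>rev_radial_gauss K \<omega>\<close>
    means \<open>A \<xi> \<in> \<omega>\<close>. The set function is thus that of a push-forward
    under \<open>A\<close>, which guarantees that \<open>measure_of\<close> takes its
    values.\<close>
  have "?M = measure_of (sphere 0 1) (sets S) (\<lambda>\<omega>. emeasure ?m (A -` \<omega> \<inter> space ?m))"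
  proof (rule measure_of_eq)
    show "sets S \<subseteq> Pow (sphere 0 1)"
      using sets.space_closed[of S] by (simp add: S_def space_restrict_space)
    fix \<omega> assume "\<omega> \<in> sigma_sets (sphere 0 1) (sets S)"
    then have \<omega> [measurable]: "\<omega> \<in> sets S"
      using sets.sigma_sets_eq[of S] by (simp add: S_def space_restrict_space)
    have "AE \<xi> in sphere_measure. \<xi> \<notin> N \<and> \<xi> \<in> sphere 0 1"
      using AE_not_in[OF N] AE_space[of "sphere_measure :: 'a measure"] by eventually_elim simp
    then have "AE \<xi> in sphere_measure. ennreal (d \<xi>) * indicator (rev_radial_gauss K \<omega>) \<xi> =
        ennreal (max 0 (D \<xi>)) * indicator (A -` \<omega> \<inter> space sphere_measure) \<xi>"
    proof eventually_elim
      case (elim \<xi>)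
      then have "\<xi> \<in> rev_radial_gauss K \<omega> \<longleftrightarrow> A \<xi> \<in> \<omega>"
        using eq[of \<xi>] by (simp add: rev_radial_gauss_def)
      then show ?case
        using elim eq[of \<xi>] by (auto simp: indicator_def max_def ennreal_neg)
    qed
    then have "set_nn_integral sphere_measure (rev_radial_gauss K \<omega>) (\<lambda>\<xi>. ennreal (d \<xi>)) =
        (\<integral>\<^sup>+ \<xi>. ennreal (max 0 (D \<xi>)) * indicator (A -` \<omega> \<inter> space sphere_measure) \<xi> \<partial>sphere_measure)"
      by (rule nn_integral_cong_AE)
    also have "\<dots> = emeasure ?m (A -` \<omega> \<inter> space ?m)"
      using measurable_sets[OF A \<omega>] by (simp add: emeasure_density)
    finally show "set_nn_integral sphere_measure (rev_radial_gauss K \<omega>) (\<lambda>\<xi>. ennreal (d \<xi>)) =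
      emeasure ?m (A -` \<omega> \<inter> space ?m)" .
  qed
  also have "\<dots> = distr ?m S A"
    by (simp add: distr_def S_def space_restrict_space)
  finally have "integral\<^sup>L ?M G = (\<integral>\<xi>. G (A \<xi>) \<partial>?m)"
    using integral_distr[OF A' G] by simp
  also have "\<dots> = (\<integral>\<xi>. max 0 (D \<xi>) * G (A \<xi>) \<partial>sphere_measure)"
    by (subst integral_density) auto
  finally show ?thesis .
qed

text \<open>The positive and the negative part of \<open>D\<close> are pushed forward separately;
  integrability of the product with \<open>g\<close> passes to both parts, and their difference
  restores \<open>D\<close>.\<close>

lemma MO_integral_eq:
  fixes K \<Omega> :: "'a::euclidean_space set"
  assumes A: "A \<in> measurable sphere_measure (restrict_space borel (sphere 0 1))"
    and D [measurable]: "D \<in> borel_measurable sphere_measure"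
    and N: "N \<in> null_sets sphere_measure"
    and eq: "\<And>\<xi>. \<xi> \<in> sphere 0 1 - N \<Longrightarrow> normals_at K \<xi> = {A \<xi>} \<and> MO_density Psi K \<xi> = D \<xi>"
    and "closed \<Omega>" "\<Omega> \<subseteq> sphere 0 1" and g: "continuous_on \<Omega> g"
    and A\<Omega>: "\<And>\<xi>. \<xi> \<in> sphere 0 1 \<Longrightarrow> A \<xi> \<in> \<Omega>"
    and int: "integrable sphere_measure (\<lambda>\<xi>. D \<xi> * g (A \<xi>))"
  shows "MO_integral Psi K \<Omega> g = (\<integral>\<xi>. D \<xi> * g (A \<xi>) \<partial>sphere_measure)"
proof -
  \<comment> \<open>\<open>g\<close> is controlled only on \<Omega>. Its extension by zero is Borel,
    and it equals \<open>g\<close> at all values of \<open>A\<close>, which lie in \<Omega>.\<close>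
  define G where "G u = indicator \<Omega> u *\<^sub>R g u" for u
  have "G \<in> borel_measurable borel"
    unfolding G_def using \<open>closed \<Omega>\<close> g by (intro borel_measurable_continuous_on_indicator) auto
  then have G: "G \<in> borel_measurable (restrict_space borel (sphere (0::'a) 1))"
    by (rule measurable_restrict_space1)
  have GA: "G (A \<xi>) = g (A \<xi>)" if "\<xi> \<in> sphere 0 1" for \<xi>
    using A\<Omega>[OF that] by (simp add: G_def)
  have [measurable]: "(\<lambda>\<xi>. G (A \<xi>)) \<in> borel_measurable sphere_measure"
    using measurable_compose[OF A G] .
  have int: "integrable sphere_measure (\<lambda>\<xi>. D \<xi> * G (A \<xi>))"
    using int by (rule Bochner_Integration.integrable_cong[THEN iffD1, rotated 2]) (auto simp: GA)
  have int_pos: "integrable sphere_measure (\<lambda>\<xi>. max 0 (D \<xi>) * G (A \<xi>))"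
    by (rule Bochner_Integration.integrable_bound[OF int]) (auto simp: abs_mult intro!: mult_right_mono)
  have int_neg: "integrable sphere_measure (\<lambda>\<xi>. max 0 (- D \<xi>) * G (A \<xi>))"
    by (rule Bochner_Integration.integrable_bound[OF int]) (auto simp: abs_mult intro!: mult_right_mono)
  have "(LINT u:\<Omega>|MO_area_pos Psi K. g u) = (\<integral>\<xi>. max 0 (D \<xi>) * G (A \<xi>) \<partial>sphere_measure)"
    unfolding MO_area_pos_def set_lebesgue_integral_def G_def[symmetric]
    using A D N eq G by (rule integral_normal_pushforward)
  moreover have "(LINT u:\<Omega>|MO_area_neg Psi K. g u) = (\<integral>\<xi>. max 0 (- D \<xi>) * G (A \<xi>) \<partial>sphere_measure)"
    unfolding MO_area_neg_def set_lebesgue_integral_def G_def[symmetric]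
    using A _ N _ G by (rule integral_normal_pushforward) (use eq in auto)
  ultimately have "MO_integral Psi K \<Omega> g =
      (\<integral>\<xi>. max 0 (D \<xi>) * G (A \<xi>) - max 0 (- D \<xi>) * G (A \<xi>) \<partial>sphere_measure)"
    unfolding MO_integral_def using int_pos int_neg by simp
  also have "\<dots> = (\<integral>\<xi>. D \<xi> * g (A \<xi>) \<partial>sphere_measure)"
    by (intro Bochner_Integration.integral_cong) (auto simp: GA max_def)
  finally show ?thesis .
qed

subsection \<open>Limits of difference quotients and of maximizers\<close>

text \<open>Scaling by \<open>R\<close> reduces to numbers of modulus at most one. The constant is
  \<open>n R^(n-1)\<close>, with a division in place of subtraction of naturals.\<close>

lemma abs_power_diff_le:
  fixes a b R :: real
  assumes "\<bar>a\<bar> \<le> R" "\<bar>b\<bar> \<le> R" "R > 0"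
  shows "\<bar>a ^ n - b ^ n\<bar> \<le> n * R ^ n / R * \<bar>a - b\<bar>"
proof -
  have "\<bar>(a / R) ^ n - (b / R) ^ n\<bar> \<le> n * \<bar>a / R - b / R\<bar>"
    using norm_power_diff[of "a / R" "b / R" n] assms by simp
  then have "R ^ n * \<bar>(a / R) ^ n - (b / R) ^ n\<bar> \<le> R ^ n * (n * \<bar>a / R - b / R\<bar>)"
    using assms by (intro mult_left_mono) auto
  moreover have "R ^ n * \<bar>(a / R) ^ n - (b / R) ^ n\<bar> = \<bar>a ^ n - b ^ n\<bar>"
    using assms by (simp add: power_divide field_simps flip: diff_divide_distrib)
  moreover have "\<bar>a / R - b / R\<bar> = \<bar>a - b\<bar> / R"
    using assms by (simp flip: diff_divide_distrib)
  ultimately show ?thesis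
    by (simp add: ac_simps)
qed

text \<open>A chain rule along a sequence; factoring out \<open>a k - b\<close> also covers indices
  with \<open>a k = b\<close>.\<close>

lemma tendsto_power_difference_quotient:
  fixes a X :: "nat \<Rightarrow> real"
  assumes "a \<longlonglongrightarrow> b" and "(\<lambda>k. (a k - b) / X k) \<longlonglongrightarrow> d"
  shows "(\<lambda>k. (a k ^ n - b ^ n) / X k) \<longlonglongrightarrow> n * b ^ (n - 1) * d"
proof -
  have "(\<lambda>k. (a k - b) / X k * (\<Sum>i<n. b ^ (n - Suc i) * a k ^ i)) \<longlonglongrightarrow>
      d * (\<Sum>i<n. b ^ (n - Suc i) * b ^ i)"
    by (intro tendsto_intros assms)
  moreover have "(\<Sum>i<n. b ^ (n - Suc i) * b ^ i) = (\<Sum>i<n. b ^ (n - 1))"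
    by (intro sum.cong) (auto simp flip: power_add)
  ultimately show ?thesis
    by (simp add: power_diff_sumr2 ac_simps)
qed

text \<open>Outside a neighbourhood of \<open>a\<close> the maximum over the remaining compact set
  lies strictly below \<open>h a\<close>, and \<open>h (z k)\<close> eventually exceeds it.\<close>

lemma tendsto_unique_maximizer:
  fixes h :: "'a::metric_space \<Rightarrow> real"
  assumes "compact A" "continuous_on A h" "a \<in> A" and max: "\<And>x. x \<in> A \<Longrightarrow> x \<noteq> a \<Longrightarrow> h x < h a"
    and z: "\<And>k. z k \<in> A" "(\<lambda>k. h (z k)) \<longlonglongrightarrow> h a"
  shows "z \<longlonglongrightarrow> a"
proof (rule topological_tendstoI)
  fix U assume U: "open U" "a \<in> U"
  show "\<forall>\<^sub>F k in sequentially. z k \<in> U"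
  proof (cases "A - U = {}")
    case True
    then show ?thesis
      using z(1) by (intro always_eventually) auto
  next
    case False
    have "compact (A - U)"
      using assms(1) U(1) by (rule compact_diff)
    then obtain y where y: "y \<in> A - U" "\<And>x. x \<in> A - U \<Longrightarrow> h x \<le> h y"
      using continuous_attains_sup[OF _ False, of h] assms(2) continuous_on_subset by blast
    have "h y < h a"
      using y(1) U(2) by (intro max) auto
    from order_tendstoD(1)[OF z(2) this] show ?thesis
      by eventually_elim (use y(2) z(1) in force)
  qed
qed

subsection \<open>The gauge and the normals of a Wulff shape\<close>

text \<open>\<open>hemisphere\<close> is the hemisphere condition read at the antipode; in this form
  it makes the gauge positive away from the origin.\<close>

locale wulff_shape =
  fixes \<Omega> :: "'a::euclidean_space set" and f :: "'a \<Rightarrow> real"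
  assumes closed_\<Omega>: "closed \<Omega>" and \<Omega>_sphere: "\<Omega> \<subseteq> sphere 0 1"
    and hemisphere: "v \<in> sphere 0 1 \<Longrightarrow> \<exists>\<xi>\<in>\<Omega>. \<xi> \<bullet> v > 0"
    and cont_f: "continuous_on \<Omega> f" and f_pos: "\<xi> \<in> \<Omega> \<Longrightarrow> f \<xi> > 0"
begin

abbreviation "K \<equiv> wulff \<Omega> f"

text \<open>Also the support function of the points \<open>\<xi> / f \<xi>\<close>, whose convex
  hull is the polar body of \<open>K\<close>.\<close>

definition wgauge :: "'a \<Rightarrow> real" where
  "wgauge x = (SUP \<xi>\<in>\<Omega>. (x \<bullet> \<xi>) / f \<xi>)"

lemma compact_\<Omega>: "compact \<Omega>"
  using closed_\<Omega> \<Omega>_sphere by (meson bounded_subset bounded_sphere compact_eq_bounded_closed)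

lemma \<Omega>_nonempty: "\<Omega> \<noteq> {}"
  using hemisphere vector_choose_size[of 1] by (metis ball_empty empty_iff mem_sphere_0 zero_le_one)

lemma f_neq_0: "\<xi> \<in> \<Omega> \<Longrightarrow> f \<xi> \<noteq> 0"
  using f_pos by force

lemma compact_gauge_image: "compact ((\<lambda>\<xi>. (x \<bullet> \<xi>) / f \<xi>) ` \<Omega>)"
  using f_neq_0 by (intro compact_continuous_image continuous_intros cont_f compact_\<Omega>) auto

lemma gauge_upper: "\<xi> \<in> \<Omega> \<Longrightarrow> (x \<bullet> \<xi>) / f \<xi> \<le> wgauge x"
  unfolding wgauge_def using compact_gauge_image
  by (intro cSUP_upper bounded_imp_bdd_above compact_imp_bounded)

lemma gauge_attained: "\<exists>\<xi>\<in>\<Omega>. (x \<bullet> \<xi>) / f \<xi> = wgauge x"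
proof -
  obtain \<xi> where "\<xi> \<in> \<Omega>" "\<And>\<zeta>. \<zeta> \<in> \<Omega> \<Longrightarrow> (x \<bullet> \<zeta>) / f \<zeta> \<le> (x \<bullet> \<xi>) / f \<xi>"
    using continuous_attains_sup[OF compact_\<Omega> \<Omega>_nonempty, of "\<lambda>\<xi>. (x \<bullet> \<xi>) / f \<xi>"] f_neq_0
    by (force intro!: continuous_intros cont_f)
  then have "wgauge x = (x \<bullet> \<xi>) / f \<xi>"
    unfolding wgauge_def by (intro cSup_eq_maximum) auto
  with \<open>\<xi> \<in> \<Omega>\<close> show ?thesis
    by auto
qed

lemma wulff_eq_gauge: "K = {x. wgauge x \<le> 1}"
proof (intro equalityI subsetI)
  fix x assume "x \<in> K"
  obtain \<xi> where \<xi>: "\<xi> \<in> \<Omega>" "(x \<bullet> \<xi>) / f \<xi> = wgauge x"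
    using gauge_attained by blast
  with \<open>x \<in> K\<close> show "x \<in> {x. wgauge x \<le> 1}"
    using f_pos[OF \<xi>(1)] by (auto simp: wulff_def divide_le_eq simp flip: \<xi>(2))
next
  fix x assume "x \<in> {x. wgauge x \<le> 1}"
  then have "(x \<bullet> \<xi>) / f \<xi> \<le> 1" if "\<xi> \<in> \<Omega>" for \<xi>
    using gauge_upper[OF that] by (metis mem_Collect_eq order_trans)
  then show "x \<in> K"
    using f_pos by (simp add: wulff_def divide_le_eq)
qed

lemma gauge_scaleR:
  assumes "t \<ge> 0" shows "wgauge (t *\<^sub>R x) = t * wgauge x"
proof (rule antisym)
  obtain \<xi> where \<xi>: "\<xi> \<in> \<Omega>" "((t *\<^sub>R x) \<bullet> \<xi>) / f \<xi> = wgauge (t *\<^sub>R x)"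
    using gauge_attained by blast
  then show "wgauge (t *\<^sub>R x) \<le> t * wgauge x"
    using mult_left_mono[OF gauge_upper[OF \<xi>(1), of x] assms] by simp
  obtain \<xi> where \<xi>: "\<xi> \<in> \<Omega>" "(x \<bullet> \<xi>) / f \<xi> = wgauge x"
    using gauge_attained by blast
  then show "t * wgauge x \<le> wgauge (t *\<^sub>R x)"
    using gauge_upper[OF \<xi>(1), of "t *\<^sub>R x"] by (simp flip: \<xi>(2))
qed

lemma gauge_0 [simp]: "wgauge 0 = 0"
  using gauge_scaleR[of 0 0] by simp

lemma gauge_pos:
  assumes "x \<noteq> 0" shows "wgauge x > 0"
proof -
  obtain \<xi> where "\<xi> \<in> \<Omega>" "\<xi> \<bullet> sgn x > 0"
    using hemisphere[of "sgn x"] assms by (auto simp: norm_sgn)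
  then have "0 < (x \<bullet> \<xi>) / f \<xi>"
    using f_pos[of \<xi>] by (simp add: sgn_div_norm inner_commute zero_less_mult_iff)
  then show ?thesis
    using gauge_upper[OF \<open>\<xi> \<in> \<Omega>\<close>, of x] by linarith
qed

text \<open>The maximizer at one point is a competitor at the other, and each function under the
  supremum is Lipschitz with constant at most \<open>1 / min f\<close>, since \<xi> is a unit
  vector.\<close>

lemma gauge_lipschitz: "\<exists>L. L-lipschitz_on UNIV wgauge"
proof -
  have "continuous_on \<Omega> (\<lambda>\<xi>. 1 / f \<xi>)"
    using f_neq_0 by (intro continuous_intros cont_f) auto
  then obtain z where z: "z \<in> \<Omega>" "\<And>\<xi>. \<xi> \<in> \<Omega> \<Longrightarrow> 1 / f \<xi> \<le> 1 / f z"
    using continuous_attains_sup[OF compact_\<Omega> \<Omega>_nonempty] by blast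
  have *: "wgauge x - wgauge y \<le> 1 / f z * norm (x - y)" for x y
  proof -
    obtain \<xi> where \<xi>: "\<xi> \<in> \<Omega>" "(x \<bullet> \<xi>) / f \<xi> = wgauge x"
      using gauge_attained by blast
    have "norm \<xi> = 1"
      using \<xi>(1) \<Omega>_sphere by auto
    have "wgauge x - wgauge y \<le> (x \<bullet> \<xi>) / f \<xi> - (y \<bullet> \<xi>) / f \<xi>"
      using gauge_upper[OF \<xi>(1), of y] \<xi>(2) by simp
    also have "\<dots> = ((x - y) \<bullet> \<xi>) * (1 / f \<xi>)"
      by (simp add: inner_diff_left diff_divide_distrib)
    also have "\<dots> \<le> norm (x - y) * (1 / f \<xi>)"
      using norm_cauchy_schwarz[of "x - y" \<xi>] f_pos[OF \<xi>(1)] \<open>norm \<xi> = 1\<close>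
      by (intro mult_right_mono) auto
    also have "\<dots> \<le> norm (x - y) * (1 / f z)"
      using z(2)[OF \<xi>(1)] by (intro mult_left_mono) auto
    finally show ?thesis
      by (simp add: mult.commute)
  qed
  have "(1 / f z)-lipschitz_on UNIV wgauge"
  proof (rule lipschitz_onI)
    show "dist (wgauge x) (wgauge y) \<le> 1 / f z * dist x y" for x y
      using *[of x y] *[of y x] by (simp add: dist_norm norm_minus_commute abs_le_iff)
  qed (use f_pos[OF z(1)] in auto)
  then show ?thesis ..
qed

lemma continuous_on_gauge: "continuous_on A wgauge"
  using gauge_lipschitz lipschitz_on_continuous_on continuous_on_subset by blast

lemma radial_fun_wulff:
  assumes "x \<noteq> 0" shows "radial_fun K x = 1 / wgauge x"
proof -
  have "{t. 0 \<le> t \<and> t *\<^sub>R x \<in> K} = {0..1 / wgauge x}"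
    using gauge_pos[OF assms] by (auto simp: wulff_eq_gauge gauge_scaleR field_simps)
  then show ?thesis
    using gauge_pos[OF assms] by (simp add: radial_fun_def)
qed

text \<open>The constraint of \<open>z\<close> bounds \<open>K\<close> by definition of the Wulff
  shape, and it is active at the boundary point \<open>x / wgauge x\<close>.\<close>

lemma maximizer_in_normals:
  assumes "x \<noteq> 0" "z \<in> \<Omega>" "(x \<bullet> z) / f z = wgauge x"
  shows "z \<in> normals_at K x"
proof -
  have "z \<bullet> (radial_fun K x *\<^sub>R x) = f z"
    using assms f_pos[of z] gauge_pos[OF assms(1)]
    by (simp add: radial_fun_wulff inner_commute field_simps)
  then show ?thesis
    using assms(2) \<Omega>_sphere by (auto simp: normals_at_def wulff_def inner_commute)
qed

text \<open>On \<Omega> the support function is in general only bounded by \<open>f\<close>;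
  equality holds here because the constraint of \<open>z\<close> touches \<open>K\<close>.\<close>

lemma supp_fun_maximizer:
  assumes "x \<noteq> 0" "z \<in> \<Omega>" "(x \<bullet> z) / f z = wgauge x"
  shows "supp_fun K z = f z"
  unfolding supp_fun_def
proof (rule cSup_eq_maximum)
  have "x /\<^sub>R wgauge x \<in> K"
    using gauge_pos[OF assms(1)] by (simp add: wulff_eq_gauge gauge_scaleR)
  moreover have "z \<bullet> (x /\<^sub>R wgauge x) = f z"
    using assms f_pos[of z] gauge_pos[OF assms(1)] by (simp add: inner_commute field_simps)
  ultimately show "f z \<in> (\<bullet>) z ` K"
    by (metis image_eqI)
qed (use assms(2) in \<open>auto simp: wulff_def inner_commute\<close>)

section \<open>Normals as subgradients, and the almost everywhere unique contact point\<close>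

text \<open>Homogeneity turns the bound \<open>v \<bullet> y \<le> c\<close> on \<open>K\<close>
  into \<open>v \<bullet> y \<le> c * wgauge y\<close> everywhere, with equality at
  \<open>x\<close>. Hence \<open>v / c\<close> is a subgradient, and \<open>sgn\<close> recovers the
  unit vector.\<close>

lemma normals_subset_subgradients:
  assumes "x \<noteq> 0" shows "normals_at K x \<subseteq> sgn ` subgradients wgauge x"
proof
  fix v assume v: "v \<in> normals_at K x"
  define c where "c = v \<bullet> (radial_fun K x *\<^sub>R x)"
  have "norm v = 1" and le: "\<And>y. y \<in> K \<Longrightarrow> v \<bullet> y \<le> c"
    using v by (auto simp: normals_at_def c_def)
  have y_le: "v \<bullet> y \<le> c * wgauge y" for y
  proof (cases "y = 0")
    case False
    then have "y /\<^sub>R wgauge y \<in> K"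
      using gauge_pos[OF False] by (simp add: wulff_eq_gauge gauge_scaleR)
    from le[OF this] show ?thesis
      using gauge_pos[OF False] by (simp add: field_simps)
  qed simp
  have "v \<bullet> v = 1" "v \<noteq> 0"
    using \<open>norm v = 1\<close> by (auto simp: dot_square_norm)
  \<comment> \<open>Testing at \<open>y = v\<close> shows that the support value \<open>c\<close> is
    positive, as needed for the division.\<close>
  then have "0 < c * wgauge v"
    using y_le[of v] by simp
  then have "c > 0"
    using gauge_pos[OF \<open>v \<noteq> 0\<close>] by (simp add: zero_less_mult_iff)
  have "v \<bullet> x = c * wgauge x"
    using gauge_pos[OF assms] by (simp add: c_def radial_fun_wulff[OF assms])
  have "v /\<^sub>R c \<in> subgradients wgauge x"
    unfolding subgradients_def
  proof (intro CollectI allI)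
    fix y
    show "wgauge x + (v /\<^sub>R c) \<bullet> (y - x) \<le> wgauge y"
      using y_le[of y] \<open>c > 0\<close> by (simp add: inner_diff_right \<open>v \<bullet> x = c * wgauge x\<close> field_simps)
  qed
  moreover have "v = sgn (v /\<^sub>R c)"
    using \<open>norm v = 1\<close> \<open>c > 0\<close> by (simp add: sgn_scaleR) (simp add: sgn_div_norm)
  ultimately show "v \<in> sgn ` subgradients wgauge x"
    by blast
qed

text \<open>Subgradients of a homogeneous function are constant along rays. The cone over the
  spherical kinks therefore consists of kinks, which makes them null for the spherical
  measure.\<close>

lemma kinks_gauge_scaleR:
  assumes "x \<in> kinks wgauge" "c > 0" shows "c *\<^sub>R x \<in> kinks wgauge"
proof -
  have "w \<in> subgradients wgauge (c *\<^sub>R x)" if w: "w \<in> subgradients wgauge x" for w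
    unfolding subgradients_def
  proof (intro CollectI allI)
    fix y
    have "wgauge x + w \<bullet> (y /\<^sub>R c - x) \<le> wgauge (y /\<^sub>R c)"
      using w unfolding subgradients_def by blast
    then have "c * (wgauge x + w \<bullet> (y /\<^sub>R c - x)) \<le> c * wgauge (y /\<^sub>R c)"
      using \<open>c > 0\<close> by simp
    also have "c * wgauge (y /\<^sub>R c) = wgauge y"
      using \<open>c > 0\<close> by (simp add: gauge_scaleR)
    also have "c * (wgauge x + w \<bullet> (y /\<^sub>R c - x)) = wgauge (c *\<^sub>R x) + w \<bullet> (y - c *\<^sub>R x)"
      using \<open>c > 0\<close> by (simp add: gauge_scaleR inner_diff_right algebra_simps)
    finally show "wgauge (c *\<^sub>R x) + w \<bullet> (y - c *\<^sub>R x) \<le> wgauge y" .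
  qed
  then show ?thesis
    using assms(1) unfolding kinks_def by blast
qed

lemma kinks_gauge_borel: "kinks wgauge \<in> sets borel"
  using gauge_lipschitz null_sets_kinks by (metis null_setsD2 sets_lborel)

lemma null_sets_kinks_gauge: "kinks wgauge \<inter> sphere 0 1 \<in> null_sets sphere_measure"
proof -
  have meas: "kinks wgauge \<inter> sphere 0 1 \<in> sets sphere_measure"
    using kinks_gauge_borel by (simp add: sets_restrict_space_iff)
  have "{x. 0 < norm x \<and> norm x \<le> 1 \<and> sgn x \<in> kinks wgauge \<inter> sphere 0 1} \<subseteq> kinks wgauge"
  proof clarify
    fix x assume "0 < norm x" "sgn x \<in> kinks wgauge"
    from kinks_gauge_scaleR[OF this(2,1)] \<open>0 < norm x\<close> show "x \<in> kinks wgauge"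
      by (simp add: sgn_div_norm)
  qed
  moreover have "kinks wgauge \<in> null_sets lborel"
    using gauge_lipschitz null_sets_kinks by blast
  ultimately have "emeasure lborel {x. 0 < norm x \<and> norm x \<le> 1 \<and> sgn x \<in> kinks wgauge \<inter> sphere 0 1} = 0"
    by (metis emeasure_mono le_zero_eq null_setsD1 null_setsD2)
  with meas show ?thesis
    by (simp add: null_sets_def emeasure_sphere_measure)
qed

lemma normals_at_wulff:
  assumes "x \<noteq> 0" "x \<notin> kinks wgauge" "z \<in> \<Omega>" "(x \<bullet> z) / f z = wgauge x"
  shows "normals_at K x = {z}"
proof -
  have "v = w" if vw: "v \<in> normals_at K x" "w \<in> normals_at K x" for v w
  proof -
    obtain v' w' where "v = sgn v'" "w = sgn w'"
      and *: "v' \<in> subgradients wgauge x" "w' \<in> subgradients wgauge x"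
      using vw normals_subset_subgradients[OF assms(1)] by blast
    moreover have "v' = w'"
      using * assms(2) unfolding kinks_def by blast
    ultimately show ?thesis
      by simp
  qed
  then show ?thesis
    using maximizer_in_normals[OF assms(1,3,4)] by blast
qed

text \<open>The equivalence describes the graph of \<open>normal_at K\<close> by a closed
  condition.\<close>

lemma normal_at_wulff:
  assumes "x \<noteq> 0" "x \<notin> kinks wgauge"
  shows "z \<in> \<Omega> \<and> (x \<bullet> z) / f z = wgauge x \<longleftrightarrow> z = normal_at K x"
proof -
  obtain y where y: "y \<in> \<Omega>" "(x \<bullet> y) / f y = wgauge x"
    using gauge_attained by blast
  from normals_at_wulff[OF assms this] have "normal_at K x = y"
    by (simp add: normal_at_def)
  moreover have "z = y" if "z \<in> \<Omega>" "(x \<bullet> z) / f z = wgauge x" for z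
    using normals_at_wulff[OF assms that] normals_at_wulff[OF assms y] by simp
  ultimately show ?thesis
    using y by blast
qed

text \<open>The graph is the zero set of a continuous function in
  \<open>?S \<times> \<Omega>\<close>, and a map with closed graph into a compact space is
  continuous. Measurability of the normal follows without a selection theorem.\<close>

lemma continuous_on_normal_at: "continuous_on (sphere 0 1 - kinks wgauge) (normal_at K)"
proof -
  let ?S = "sphere 0 1 - kinks wgauge"
  have nz: "x \<noteq> 0" if "x \<in> ?S" for x
    using that by auto
  have eq: "(\<lambda>x. (x, normal_at K x)) ` ?S =
      ?S \<times> \<Omega> \<inter> (\<lambda>z. (fst z \<bullet> snd z) / f (snd z) - wgauge (fst z)) -` {0}"
  proof (intro equalityI subsetI)
    fix u assume "u \<in> (\<lambda>x. (x, normal_at K x)) ` ?S"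
    then obtain x where "x \<in> ?S" "u = (x, normal_at K x)"
      by blast
    then show "u \<in> ?S \<times> \<Omega> \<inter> (\<lambda>z. (fst z \<bullet> snd z) / f (snd z) - wgauge (fst z)) -` {0}"
      using normal_at_wulff[OF nz, of x "normal_at K x"] by simp
  next
    fix u assume "u \<in> ?S \<times> \<Omega> \<inter> (\<lambda>z. (fst z \<bullet> snd z) / f (snd z) - wgauge (fst z)) -` {0}"
    then show "u \<in> (\<lambda>x. (x, normal_at K x)) ` ?S"
      using normal_at_wulff[OF nz, of "fst u" "snd u"] by (cases u) auto
  qed
  have f: "continuous_on (?S \<times> \<Omega>) (\<lambda>z. f (snd z))"
    by (rule continuous_on_compose2[OF cont_f]) (auto intro!: continuous_intros)
  have p: "continuous_on (?S \<times> \<Omega>) (\<lambda>z. wgauge (fst z))"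
    by (rule continuous_on_compose2[OF continuous_on_gauge[of UNIV]]) (auto intro!: continuous_intros)
  have "closedin (top_of_set (?S \<times> \<Omega>)) ((\<lambda>x. (x, normal_at K x)) ` ?S)"
    unfolding eq using f_neq_0
    by (intro continuous_closedin_preimage closed_singleton continuous_intros f p) auto
  moreover have "normal_at K \<in> ?S \<rightarrow> \<Omega>"
    using normal_at_wulff[OF nz] by blast
  ultimately show ?thesis
    using continuous_closed_graph_eq[OF compact_\<Omega>] by blast
qed

section \<open>Null boundary and volume in polar coordinates\<close>

lemma convex_wulff: "convex K"
proof -
  have "K = (\<Inter>\<xi>\<in>\<Omega>. {x. \<xi> \<bullet> x \<le> f \<xi>})"
    by (auto simp: wulff_def inner_commute)
  then show ?thesis
    by (simp add: convex_INT convex_halfspace_le)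
qed

lemma closed_wulff: "closed K"
  unfolding wulff_eq_gauge by (intro closed_Collect_le continuous_on_gauge continuous_intros)

lemma gauge_lower: "\<exists>c>0. \<forall>x. c * norm x \<le> wgauge x"
proof -
  have "sphere (0::'a) 1 \<noteq> {}"
    using vector_choose_size[of 1] by (metis empty_iff mem_sphere_0 zero_le_one)
  then obtain z where z: "z \<in> sphere 0 1" "\<And>x. x \<in> sphere 0 1 \<Longrightarrow> wgauge z \<le> wgauge x"
    using continuous_attains_inf[OF compact_sphere _ continuous_on_gauge] by blast
  have "wgauge z * norm x \<le> wgauge x" for x
  proof (cases "x = 0")
    case False
    then have "wgauge z \<le> wgauge (sgn x)"
      by (intro z) (simp add: norm_sgn)
    then show ?thesis
      using False by (simp add: sgn_div_norm gauge_scaleR field_simps)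
  qed simp
  moreover have "wgauge z > 0"
    using z(1) by (intro gauge_pos) auto
  ultimately show ?thesis
    by blast
qed

text \<open>An interior point can be moved outwards within \<open>K\<close>, and the gauge grows
  strictly along rays. So the level set at 1 lies in the frontier of a convex set, which is
  null.\<close>

lemma gauge_less_1_interior:
  assumes "x \<in> interior K" shows "wgauge x < 1"
proof (cases "x = 0")
  case False
  obtain e where e: "e > 0" "cball x e \<subseteq> K"
    using assms mem_interior_cball by blast
  have "x + (e / norm x) *\<^sub>R x \<in> cball x e"
    using False e(1) by (simp add: dist_norm)
  then have "wgauge ((1 + e / norm x) *\<^sub>R x) \<le> 1"
    using e(2) by (auto simp: wulff_eq_gauge scaleR_left_distrib)
  then have "(1 + e / norm x) * wgauge x \<le> 1"
    using e(1) by (subst (asm) gauge_scaleR) auto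
  moreover have "wgauge x < (1 + e / norm x) * wgauge x"
    using False e(1) gauge_pos[OF False] by (simp add: distrib_right)
  ultimately show ?thesis
    by linarith
qed simp

lemma borel_measurable_gauge [measurable]: "wgauge \<in> borel_measurable sphere_measure"
proof -
  have "wgauge \<in> borel_measurable (restrict_space borel (sphere 0 1))"
    by (intro borel_measurable_continuous_on_restrict continuous_on_gauge)
  then show ?thesis
    by (simp cong: measurable_cong_sets)
qed

lemma measure_wulff:
  "measure lebesgue K = (\<integral>\<xi>. (1 / wgauge \<xi>) ^ DIM('a) \<partial>sphere_measure) / DIM('a)"
proof -
  \<comment> \<open>The polar formula measures the strict sublevel set without the origin; it
    differs from \<open>K\<close> at most in the frontier and in one point.\<close>
  let ?L = "{x. x \<noteq> 0 \<and> ennreal (norm x) < ennreal (1 / wgauge (sgn x))}"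
  have L: "?L = {x. wgauge x < 1} - {0}"
  proof -
    have "ennreal (norm x) < ennreal (1 / wgauge (sgn x)) \<longleftrightarrow> wgauge x < 1" if "x \<noteq> 0" for x
      using that gauge_pos[OF that] by (simp add: sgn_div_norm gauge_scaleR ennreal_less_iff field_simps)
    then show ?thesis
      by auto
  qed
  have "open {x. wgauge x < 1}"
    by (intro open_Collect_less continuous_on_gauge continuous_intros)
  then have "?L \<in> sets lborel"
    unfolding L by simp
  moreover have "AE x in lborel. x \<notin> frontier K" "AE x in lborel. x \<noteq> (0::'a)"
    using negligible_convex_frontier[OF convex_wulff] AE_lborel_singleton[of 0]
    by (auto simp: null_sets_completion_iff negligible_iff_null_sets intro: AE_not_in)
  then have "AE x in lborel. x \<in> K \<longleftrightarrow> x \<in> ?L"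
  proof eventually_elim
    case (elim x)
    then show ?case
      unfolding L using gauge_less_1_interior[of x] closed_wulff
      by (auto simp: frontier_def wulff_eq_gauge)
  qed
  ultimately have "emeasure lborel K = emeasure lborel ?L"
    using closed_wulff by (intro emeasure_eq_AE) auto
  then have "DIM('a) * emeasure lborel K = (\<integral>\<^sup>+ \<xi>. ennreal (1 / wgauge \<xi>) ^ DIM('a) \<partial>sphere_measure)"
    using nn_integral_sphere_power[of "\<lambda>\<xi>. ennreal (1 / wgauge \<xi>)"] by simp
  also have "\<dots> = (\<integral>\<^sup>+ \<xi>. ennreal ((1 / wgauge \<xi>) ^ DIM('a)) \<partial>sphere_measure)"
  proof (intro nn_integral_cong)
    fix \<xi> :: 'a assume "\<xi> \<in> space sphere_measure"
    then have "wgauge \<xi> > 0"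
      by (intro gauge_pos) auto
    then show "ennreal (1 / wgauge \<xi>) ^ DIM('a) = ennreal ((1 / wgauge \<xi>) ^ DIM('a))"
      by (simp add: ennreal_power)
  qed
  finally have *: "DIM('a) * emeasure lborel K = (\<integral>\<^sup>+ \<xi>. ennreal ((1 / wgauge \<xi>) ^ DIM('a)) \<partial>sphere_measure)" .
  have "AE \<xi> in sphere_measure. 0 \<le> (1 / wgauge \<xi>) ^ DIM('a)"
    using AE_space
  proof eventually_elim
    case (elim \<xi>)
    then have "wgauge \<xi> > 0"
      by (intro gauge_pos) auto
    then show ?case
      by simp
  qed
  then have "(\<integral>\<xi>. (1 / wgauge \<xi>) ^ DIM('a) \<partial>sphere_measure) = enn2real (DIM('a) * emeasure lborel K)"
    unfolding * by (intro integral_eq_nn_integral) auto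
  also have "\<dots> = DIM('a) * measure lebesgue K"
    using closed_wulff by (simp add: measure_def enn2real_mult)
  finally show ?thesis
    by simp
qed

text \<open>A constant value in \<Omega> replaces the uncontrolled choice on the kinks and off the
  sphere, which makes the map total, Borel and \<Omega>-valued.\<close>

definition contact :: "'a \<Rightarrow> 'a" where
  "contact \<xi> = (if \<xi> \<in> sphere 0 1 - kinks wgauge then normal_at K \<xi> else SOME z. z \<in> \<Omega>)"

lemma contact_eq:
  assumes "\<xi> \<in> sphere 0 1 - kinks wgauge"
  shows "contact \<xi> = normal_at K \<xi>" "(\<xi> \<bullet> contact \<xi>) / f (contact \<xi>) = wgauge \<xi>"
    "z \<in> \<Omega> \<Longrightarrow> (\<xi> \<bullet> z) / f z = wgauge \<xi> \<Longrightarrow> z = contact \<xi>"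
proof -
  show eq: "contact \<xi> = normal_at K \<xi>"
    using assms by (simp add: contact_def)
  have "\<xi> \<noteq> 0" "\<xi> \<notin> kinks wgauge"
    using assms by auto
  note * = normal_at_wulff[OF this]
  show "(\<xi> \<bullet> contact \<xi>) / f (contact \<xi>) = wgauge \<xi>"
    using * eq by blast
  show "z \<in> \<Omega> \<Longrightarrow> (\<xi> \<bullet> z) / f z = wgauge \<xi> \<Longrightarrow> z = contact \<xi>"
    unfolding eq using *[of z] by blast
qed

lemma contact_in: "contact \<xi> \<in> \<Omega>"
proof (cases "\<xi> \<in> sphere 0 1 - kinks wgauge")
  case True
  then have "\<xi> \<noteq> 0" "\<xi> \<notin> kinks wgauge"
    by auto
  from normal_at_wulff[OF this] show ?thesis
    using contact_eq(1)[OF True] by blast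
next
  case False
  then show ?thesis
    unfolding contact_def if_not_P[OF False] by (simp add: some_in_eq \<Omega>_nonempty)
qed

lemma measurable_contact: "contact \<in> measurable sphere_measure (restrict_space borel \<Omega>)"
proof (rule measurable_restrict_space2)
  have "contact \<in> borel_measurable borel"
    unfolding contact_def using kinks_gauge_borel
    by (intro borel_measurable_continuous_on_if continuous_on_normal_at continuous_intros) auto
  then show "contact \<in> borel_measurable sphere_measure"
    by (simp add: measurable_restrict_space1 cong: measurable_cong_sets)
qed (use contact_in in auto)

lemma borel_measurable_contact:
  fixes h :: "'a \<Rightarrow> real"
  assumes "continuous_on \<Omega> h"
  shows "(\<lambda>\<xi>. h (contact \<xi>)) \<in> borel_measurable sphere_measure"
  using measurable_contact borel_measurable_continuous_on_restrict[OF assms]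
  by (rule measurable_compose)

subsection \<open>The first variation of the volume\<close>

text \<open>Differentiability of \<open>F\<close> at \<open>0\<close> with derivative \<open>D\<close>, uniformly on \<open>\<Omega>\<close>; uniformity is
  phrased as continuous convergence of the difference quotients.\<close>
definition uniform_variation :: "(real \<Rightarrow> 'a \<Rightarrow> real) \<Rightarrow> ('a \<Rightarrow> real) \<Rightarrow> bool" where
  "uniform_variation F D \<longleftrightarrow> (\<exists>\<delta>>0. \<exists>m>0. \<exists>M C.
     (\<forall>\<epsilon>. \<bar>\<epsilon>\<bar> < \<delta> \<longrightarrow> continuous_on \<Omega> (F \<epsilon>)) \<and>
     (\<forall>\<epsilon>. \<forall>z\<in>\<Omega>. \<bar>\<epsilon>\<bar> < \<delta> \<longrightarrow> m \<le> F \<epsilon> z \<and> F \<epsilon> z \<le> M \<and> \<bar>F \<epsilon> z - f z\<bar> \<le> C * \<bar>\<epsilon>\<bar>) \<and>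
     (\<forall>X z a. (\<forall>k. \<bar>X k\<bar> < \<delta> \<and> X k \<noteq> 0 \<and> z k \<in> \<Omega>) \<longrightarrow> X \<longlonglongrightarrow> 0 \<longrightarrow> z \<longlonglongrightarrow> a \<longrightarrow> a \<in> \<Omega> \<longrightarrow>
       (\<lambda>k. (F (X k) (z k) - f (z k)) / X k) \<longlonglongrightarrow> D a))"

text \<open>Since the gauges near \<epsilon> = 0 are bounded below on the sphere and Lipschitz in
  \<epsilon> at 0, uniformly in the direction, a constant dominates the difference quotients; it is
  integrable because the spherical measure is finite.\<close>

theorem wulff_volume_variation:
  assumes var: "uniform_variation F D" and D: "continuous_on \<Omega> D"
  shows "integrable sphere_measure (\<lambda>\<xi>. (1 / wgauge \<xi>) ^ DIM('a) * (D (contact \<xi>) / f (contact \<xi>)))"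
      (is "integrable _ ?I")
    and "((\<lambda>\<epsilon>. (measure lebesgue (wulff \<Omega> (F \<epsilon>)) - measure lebesgue K) / \<epsilon>)
      \<longlongrightarrow> (\<integral>\<xi>. (1 / wgauge \<xi>) ^ DIM('a) * (D (contact \<xi>) / f (contact \<xi>)) \<partial>sphere_measure)) (at 0)"
proof -
  obtain \<delta> m M C where "\<delta> > 0" "m > 0"
    and cont: "\<And>\<epsilon>. \<bar>\<epsilon>\<bar> < \<delta> \<Longrightarrow> continuous_on \<Omega> (F \<epsilon>)"
    and F: "\<And>\<epsilon> z. \<bar>\<epsilon>\<bar> < \<delta> \<Longrightarrow> z \<in> \<Omega> \<Longrightarrow> m \<le> F \<epsilon> z \<and> F \<epsilon> z \<le> M \<and> \<bar>F \<epsilon> z - f z\<bar> \<le> C * \<bar>\<epsilon>\<bar>"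
    and lim: "\<And>X z a. (\<And>k. \<bar>X k\<bar> < \<delta> \<and> X k \<noteq> 0 \<and> z k \<in> \<Omega>) \<Longrightarrow> X \<longlonglongrightarrow> 0 \<Longrightarrow> z \<longlonglongrightarrow> a \<Longrightarrow> a \<in> \<Omega> \<Longrightarrow>
       (\<lambda>k. (F (X k) (z k) - f (z k)) / X k) \<longlonglongrightarrow> D a"
    using var unfolding uniform_variation_def by blast
  \<comment> \<open>At \<epsilon> = 0 the last estimate forces \<open>F 0 z = f z\<close>, so
    \<open>f\<close> inherits the bounds.\<close>
  have f: "m \<le> f z \<and> f z \<le> M" if "z \<in> \<Omega>" for z
    using F[of 0 z] \<open>\<delta> > 0\<close> that by auto
  obtain z0 where "z0 \<in> \<Omega>"
    using \<Omega>_nonempty by blast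
  have "M > 0"
    using f[OF \<open>z0 \<in> \<Omega>\<close>] \<open>m > 0\<close> by linarith
  have "C \<ge> 0"
    using F[of "\<delta> / 2" z0] \<open>z0 \<in> \<Omega>\<close> \<open>\<delta> > 0\<close>
    by (smt (verit, best) abs_ge_zero half_gt_zero field_sum_of_halves zero_le_mult_iff)
  define p where "p \<epsilon> = wulff_shape.wgauge \<Omega> (F \<epsilon>)" for \<epsilon>
  have shape: "wulff_shape \<Omega> (F \<epsilon>)" if "\<bar>\<epsilon>\<bar> < \<delta>" for \<epsilon>
    using closed_\<Omega> \<Omega>_sphere hemisphere cont[OF that] F[OF that] \<open>m > 0\<close>
    by unfold_locales force+
  have upper: "(x \<bullet> z) / F \<epsilon> z \<le> p \<epsilon> x" if "\<bar>\<epsilon>\<bar> < \<delta>" "z \<in> \<Omega>" for x z \<epsilon>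
    using wulff_shape.gauge_upper[OF shape] that unfolding p_def by blast
  have attained: "\<exists>z\<in>\<Omega>. (x \<bullet> z) / F \<epsilon> z = p \<epsilon> x" if "\<bar>\<epsilon>\<bar> < \<delta>" for x \<epsilon>
    using wulff_shape.gauge_attained[OF shape] that unfolding p_def by blast
  have diff_inv: "\<bar>(x \<bullet> z) / F \<epsilon> z - (x \<bullet> z) / f z\<bar> \<le> C / m\<^sup>2 * \<bar>\<epsilon>\<bar>"
    if "norm x = 1" "z \<in> \<Omega>" "\<bar>\<epsilon>\<bar> < \<delta>" for x z \<epsilon>
  proof -
    have pos: "m \<le> F \<epsilon> z" "m \<le> f z" "F \<epsilon> z > 0" "f z > 0"
      using F[OF that(3,2)] f[OF that(2)] \<open>m > 0\<close> by auto
    have "\<bar>x \<bullet> z\<bar> \<le> 1"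
      using Cauchy_Schwarz_ineq2[of x z] that \<Omega>_sphere by auto
    have "(x \<bullet> z) / F \<epsilon> z - (x \<bullet> z) / f z = (x \<bullet> z) * (f z - F \<epsilon> z) / (F \<epsilon> z * f z)"
      using pos by (simp add: field_simps)
    then have "\<bar>(x \<bullet> z) / F \<epsilon> z - (x \<bullet> z) / f z\<bar> = \<bar>x \<bullet> z\<bar> * \<bar>F \<epsilon> z - f z\<bar> / (F \<epsilon> z * f z)"
      using pos by (simp add: abs_mult abs_minus_commute)
    also have "\<dots> \<le> 1 * (C * \<bar>\<epsilon>\<bar>) / (m * m)"
      using pos \<open>m > 0\<close> \<open>\<bar>x \<bullet> z\<bar> \<le> 1\<close> F[OF that(3,2)] by (intro frac_le mult_mono) auto
    finally show ?thesis
      by (simp add: power2_eq_square)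
  qed
  have p_diff: "\<bar>p \<epsilon> x - wgauge x\<bar> \<le> C / m\<^sup>2 * \<bar>\<epsilon>\<bar>" if x: "norm x = 1" "\<bar>\<epsilon>\<bar> < \<delta>" for x \<epsilon>
  proof -
    obtain y where y: "y \<in> \<Omega>" "(x \<bullet> y) / F \<epsilon> y = p \<epsilon> x"
      using attained[OF x(2)] by blast
    obtain z where z: "z \<in> \<Omega>" "(x \<bullet> z) / f z = wgauge x"
      using gauge_attained by blast
    show ?thesis
      using y z diff_inv[OF x(1) y(1) x(2)] diff_inv[OF x(1) z(1) x(2)]
        upper[OF x(2) z(1), of x] gauge_upper[OF y(1), of x] by linarith
  qed
  obtain c where c: "c > 0" "\<And>x. c * norm x \<le> wgauge x"
    using gauge_lower by blast
  \<comment> \<open>A maximizer z for \<open>f\<close> at a unit vector x has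
    \<open>x \<bullet> z \<ge> c * f z \<ge> c * m\<close>. As a competitor for
    \<open>F \<epsilon> \<le> M\<close> it yields \<open>c * m / M\<close>.\<close>
  define b where "b = min c (c * m / M)"
  have "b > 0"
    using c(1) \<open>m > 0\<close> \<open>M > 0\<close> by (simp add: b_def)
  have b: "b \<le> wgauge x" "b \<le> p \<epsilon> x" if x: "norm x = 1" "\<bar>\<epsilon>\<bar> < \<delta>" for x \<epsilon>
  proof -
    show "b \<le> wgauge x"
      using c(2)[of x] x(1) by (simp add: b_def)
    obtain z where z: "z \<in> \<Omega>" "(x \<bullet> z) / f z = wgauge x"
      using gauge_attained by blast
    have "c \<le> (x \<bullet> z) / f z"
      using c(2)[of x] x(1) z by simp
    then have "c * f z \<le> x \<bullet> z"
      using f[OF z(1)] \<open>m > 0\<close> by (simp add: field_simps)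
    then have "c * m \<le> x \<bullet> z"
      using f[OF z(1)] c(1) by (smt (verit) mult_left_mono)
    then have "0 \<le> x \<bullet> z"
      using mult_pos_pos[OF c(1) \<open>m > 0\<close>] by linarith
    have "b \<le> c * m / M"
      by (simp add: b_def)
    also have "\<dots> \<le> (x \<bullet> z) / F \<epsilon> z"
      using \<open>0 \<le> x \<bullet> z\<close> \<open>c * m \<le> x \<bullet> z\<close> F[OF x(2) z(1)] c(1) \<open>m > 0\<close> by (intro frac_le) auto
    also have "\<dots> \<le> p \<epsilon> x"
      using upper[OF x(2) z(1)] .
    finally show "b \<le> p \<epsilon> x" .
  qed
  \<comment> \<open>The Lipschitz constant \<open>n (1/b)^(n-1)\<close> of the n-th power up to
    \<open>1 / b\<close>, times the bound \<open>C / m^2\<close> for the gauge, times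
    \<open>1 / b^2\<close> from taking reciprocals.\<close>
  define B where "B = DIM('a) * (1 / b) ^ DIM('a) / (1 / b) * (C / m\<^sup>2 / (b * b))"
  have quot_bound: "\<bar>((1 / p \<epsilon> x) ^ DIM('a) - (1 / wgauge x) ^ DIM('a)) / \<epsilon>\<bar> \<le> B"
    if "norm x = 1" "\<bar>\<epsilon>\<bar> < \<delta>" "\<epsilon> \<noteq> 0" for x \<epsilon>
  proof -
    note b' = b[OF that(1,2)]
    have pos: "p \<epsilon> x > 0" "wgauge x > 0"
      using b' \<open>b > 0\<close> by auto
    have "1 / p \<epsilon> x - 1 / wgauge x = (wgauge x - p \<epsilon> x) / (p \<epsilon> x * wgauge x)"
      using pos by (simp add: field_simps)
    then have "\<bar>1 / p \<epsilon> x - 1 / wgauge x\<bar> = \<bar>p \<epsilon> x - wgauge x\<bar> / (p \<epsilon> x * wgauge x)"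
      using pos by (simp add: abs_minus_commute abs_mult)
    also have "\<dots> \<le> (C / m\<^sup>2 * \<bar>\<epsilon>\<bar>) / (b * b)"
      using p_diff[OF that(1,2)] b' \<open>b > 0\<close> by (intro frac_le mult_mono) auto
    finally have *: "\<bar>1 / p \<epsilon> x - 1 / wgauge x\<bar> \<le> C / m\<^sup>2 / (b * b) * \<bar>\<epsilon>\<bar>"
      by simp
    have "\<bar>1 / p \<epsilon> x\<bar> \<le> 1 / b" "\<bar>1 / wgauge x\<bar> \<le> 1 / b"
      using pos b' \<open>b > 0\<close> by (simp_all add: frac_le)
    then have "\<bar>(1 / p \<epsilon> x) ^ DIM('a) - (1 / wgauge x) ^ DIM('a)\<bar> \<le>
        DIM('a) * (1 / b) ^ DIM('a) / (1 / b) * \<bar>1 / p \<epsilon> x - 1 / wgauge x\<bar>"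
      using \<open>b > 0\<close> by (intro abs_power_diff_le) auto
    also have "\<dots> \<le> DIM('a) * (1 / b) ^ DIM('a) / (1 / b) * (C / m\<^sup>2 / (b * b) * \<bar>\<epsilon>\<bar>)"
      using * \<open>b > 0\<close> by (intro mult_left_mono) auto
    also have "\<dots> = B * \<bar>\<epsilon>\<bar>"
      by (simp add: B_def)
    finally show ?thesis
      using that(3) by (simp add: abs_divide divide_le_eq)
  qed
  have pointwise: "(\<lambda>k. ((1 / p (X k) \<xi>) ^ DIM('a) - (1 / wgauge \<xi>) ^ DIM('a)) / X k) \<longlonglongrightarrow> DIM('a) * ?I \<xi>"
    if X: "\<And>k. \<bar>X k\<bar> < \<delta> \<and> X k \<noteq> 0" "X \<longlonglongrightarrow> 0" and \<xi>: "\<xi> \<in> sphere 0 1 - kinks wgauge" for X \<xi>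
  proof -
    have "norm \<xi> = 1"
      using \<xi> by auto
    define a where "a = contact \<xi>"
    have a: "a \<in> \<Omega>" "(\<xi> \<bullet> a) / f a = wgauge \<xi>"
      using contact_in contact_eq(2)[OF \<xi>] by (auto simp: a_def)
    have "\<forall>k. \<exists>z\<in>\<Omega>. (\<xi> \<bullet> z) / F (X k) z = p (X k) \<xi>"
      using attained X(1) by blast
    then obtain z where z: "\<And>k. z k \<in> \<Omega>" "\<And>k. (\<xi> \<bullet> z k) / F (X k) (z k) = p (X k) \<xi>"
      by metis
    have X0: "(\<lambda>k. C' * \<bar>X k\<bar>) \<longlonglongrightarrow> 0" for C'
      using tendsto_mult[OF tendsto_const tendsto_rabs[OF X(2)], of C'] by simp
    have p_lim: "(\<lambda>k. p (X k) \<xi>) \<longlonglongrightarrow> wgauge \<xi>"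
    proof (rule LIM_zero_cancel, rule Lim_null_comparison[OF _ X0[of "C / m\<^sup>2"]])
      show "\<forall>\<^sub>F k in sequentially. norm (p (X k) \<xi> - wgauge \<xi>) \<le> C / m\<^sup>2 * \<bar>X k\<bar>"
        using p_diff[OF \<open>norm \<xi> = 1\<close>] X(1) by (intro always_eventually) auto
    qed
    have "norm ((\<xi> \<bullet> z k) / f (z k) - p (X k) \<xi>) \<le> C / m\<^sup>2 * \<bar>X k\<bar>" for k
      using diff_inv[OF \<open>norm \<xi> = 1\<close> z(1)[of k], of "X k"] X(1)[of k] z(2)[of k]
      by (simp add: abs_minus_commute)
    then have "(\<lambda>k. (\<xi> \<bullet> z k) / f (z k) - p (X k) \<xi>) \<longlonglongrightarrow> 0"
      by (intro Lim_null_comparison[OF _ X0[of "C / m\<^sup>2"]] always_eventually) auto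
    from tendsto_add[OF this p_lim] have h_lim: "(\<lambda>k. (\<xi> \<bullet> z k) / f (z k)) \<longlonglongrightarrow> wgauge \<xi>"
      by simp
    \<comment> \<open>The perturbed maximizers are nearly maximal for \<open>f\<close>, and off the
      kinks the maximizer for \<open>f\<close> is unique.\<close>
    have z_lim: "z \<longlonglongrightarrow> a"
    proof (rule tendsto_unique_maximizer[OF compact_\<Omega>])
      show "continuous_on \<Omega> (\<lambda>z. (\<xi> \<bullet> z) / f z)"
        using f_neq_0 by (intro continuous_intros cont_f) auto
      show "(\<xi> \<bullet> x) / f x < (\<xi> \<bullet> a) / f a" if "x \<in> \<Omega>" "x \<noteq> a" for x
        using gauge_upper[OF that(1), of \<xi>] contact_eq(3)[OF \<xi> that(1)] that(2) a
        by (auto simp: a_def[symmetric] less_le)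
    qed (use a z h_lim in auto)
    \<comment> \<open>The limit is the derivative \<open>- (\<xi> \<bullet> a) D a / (f a)^2\<close>
      with \<open>(\<xi> \<bullet> a) / f a\<close> read as the gauge. It is applied to the constant
      sequence \<open>a\<close> and to \<open>z\<close>.\<close>
    have quot: "(\<lambda>k. ((\<xi> \<bullet> y k) / F (X k) (y k) - (\<xi> \<bullet> y k) / f (y k)) / X k) \<longlonglongrightarrow>
        - (wgauge \<xi> * (D a / f a))" if y: "\<And>k. y k \<in> \<Omega>" "y \<longlonglongrightarrow> a" for y
    proof -
      have f_lim: "(\<lambda>k. f (y k)) \<longlonglongrightarrow> f a"
        using cont_f y a(1) by (intro continuous_on_tendsto_compose[OF cont_f]) auto
      have "(\<lambda>k. F (X k) (y k) - f (y k)) \<longlonglongrightarrow> 0"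
        using F[OF _ y(1)] X(1)
        by (intro Lim_null_comparison[OF _ X0[of C]] always_eventually) auto
      from tendsto_add[OF this f_lim] have F_lim: "(\<lambda>k. F (X k) (y k)) \<longlonglongrightarrow> f a"
        by simp
      have "(\<lambda>k. (F (X k) (y k) - f (y k)) / X k) \<longlonglongrightarrow> D a"
        using X y a(1) by (intro lim) auto
      then have "(\<lambda>k. - ((\<xi> \<bullet> y k) * ((F (X k) (y k) - f (y k)) / X k) / (F (X k) (y k) * f (y k)))) \<longlonglongrightarrow>
          - ((\<xi> \<bullet> a) * D a / (f a * f a))"
        using f_neq_0[OF a(1)] by (intro tendsto_intros f_lim F_lim y(2)) auto
      moreover have "- ((\<xi> \<bullet> a) * D a / (f a * f a)) = - (wgauge \<xi> * (D a / f a))"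
        by (simp add: a(2)[symmetric])
      moreover have "- ((\<xi> \<bullet> y k) * ((F (X k) (y k) - f (y k)) / X k) / (F (X k) (y k) * f (y k))) =
          ((\<xi> \<bullet> y k) / F (X k) (y k) - (\<xi> \<bullet> y k) / f (y k)) / X k" for k
      proof -
        have "F (X k) (y k) \<noteq> 0" "f (y k) \<noteq> 0" "X k \<noteq> 0"
          using F[OF _ y(1)[of k], of "X k"] X(1)[of k] f_neq_0[OF y(1)[of k]] \<open>m > 0\<close> by auto
        then show ?thesis
          by (simp add: divide_simps) (simp add: algebra_simps)
      qed
      ultimately show ?thesis
        by simp
    qed
    define u where "u k = ((\<xi> \<bullet> a) / F (X k) a - (\<xi> \<bullet> a) / f a) / X k" for k
    define v where "v k = ((\<xi> \<bullet> z k) / F (X k) (z k) - (\<xi> \<bullet> z k) / f (z k)) / X k" for k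
    have u: "u \<longlonglongrightarrow> - (wgauge \<xi> * (D a / f a))"
      unfolding u_def using a(1) by (intro quot) auto
    have v: "v \<longlonglongrightarrow> - (wgauge \<xi> * (D a / f a))"
      unfolding v_def using z z_lim by (intro quot) auto
    text \<open>The maximizer for \<open>f\<close> bounds the increment of the gauge from below, the maximizer for
      \<open>F (X k)\<close> bounds it from above; dividing by \<open>X k\<close> may swap the two.\<close>
    have between: "min (u k) (v k) \<le> (p (X k) \<xi> - wgauge \<xi>) / X k \<and>
        (p (X k) \<xi> - wgauge \<xi>) / X k \<le> max (u k) (v k)" for k
    proof -
      have 1: "(\<xi> \<bullet> a) / F (X k) a - (\<xi> \<bullet> a) / f a \<le> p (X k) \<xi> - wgauge \<xi>"
        using upper[of "X k" a \<xi>] X(1)[of k] a by simp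
      have 2: "p (X k) \<xi> - wgauge \<xi> \<le> (\<xi> \<bullet> z k) / F (X k) (z k) - (\<xi> \<bullet> z k) / f (z k)"
        using gauge_upper[OF z(1), of \<xi> k] z(2)[of k] by simp
      show ?thesis
      proof (cases "X k > 0")
        case True
        then show ?thesis
          using divide_right_mono[OF 1, of "X k"] divide_right_mono[OF 2, of "X k"]
          by (simp add: u_def v_def)
      next
        case False
        then show ?thesis
          using divide_right_mono_neg[OF 1, of "X k"] divide_right_mono_neg[OF 2, of "X k"]
          by (simp add: u_def v_def)
      qed
    qed
    have p_quot: "(\<lambda>k. (p (X k) \<xi> - wgauge \<xi>) / X k) \<longlonglongrightarrow> - (wgauge \<xi> * (D a / f a))"
    proof (rule tendsto_sandwich)
      show "(\<lambda>k. min (u k) (v k)) \<longlonglongrightarrow> - (wgauge \<xi> * (D a / f a))"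
        using tendsto_min[OF u v] by simp
      show "(\<lambda>k. max (u k) (v k)) \<longlonglongrightarrow> - (wgauge \<xi> * (D a / f a))"
        using tendsto_max[OF u v] by simp
    qed (use between in auto)
    have "wgauge \<xi> > 0"
      using b(1)[OF \<open>norm \<xi> = 1\<close>, of 0] \<open>b > 0\<close> \<open>\<delta> > 0\<close> by simp
    have inv_lim: "(\<lambda>k. 1 / p (X k) \<xi>) \<longlonglongrightarrow> 1 / wgauge \<xi>"
      using \<open>wgauge \<xi> > 0\<close> by (intro tendsto_intros p_lim) auto
    have "(\<lambda>k. - ((p (X k) \<xi> - wgauge \<xi>) / X k * (1 / p (X k) \<xi>) * (1 / wgauge \<xi>))) \<longlonglongrightarrow>
        - (- (wgauge \<xi> * (D a / f a)) * (1 / wgauge \<xi>) * (1 / wgauge \<xi>))"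
      by (intro tendsto_intros p_quot inv_lim)
    moreover have "- ((p (X k) \<xi> - wgauge \<xi>) / X k * (1 / p (X k) \<xi>) * (1 / wgauge \<xi>)) =
        (1 / p (X k) \<xi> - 1 / wgauge \<xi>) / X k" for k
    proof -
      have "p (X k) \<xi> > 0" "X k \<noteq> 0"
        using b(2)[OF \<open>norm \<xi> = 1\<close>, of "X k"] \<open>b > 0\<close> X(1)[of k] by auto
      then show ?thesis
        using \<open>wgauge \<xi> > 0\<close> by (simp add: divide_simps)
    qed
    ultimately have "(\<lambda>k. (1 / p (X k) \<xi> - 1 / wgauge \<xi>) / X k) \<longlonglongrightarrow> 1 / wgauge \<xi> * (D a / f a)"
      using \<open>wgauge \<xi> > 0\<close> by (simp add: mult.commute)
    from tendsto_power_difference_quotient[OF inv_lim this, of "DIM('a)"]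
    have "(\<lambda>k. ((1 / p (X k) \<xi>) ^ DIM('a) - (1 / wgauge \<xi>) ^ DIM('a)) / X k) \<longlonglongrightarrow>
        DIM('a) * ((1 / wgauge \<xi>) ^ (DIM('a) - 1) * (1 / wgauge \<xi>)) * (D a / f a)"
      by (simp only: mult.assoc)
    also have "(1 / wgauge \<xi>) ^ (DIM('a) - 1) * (1 / wgauge \<xi>) = (1 / wgauge \<xi>) ^ DIM('a)"
      by (rule power_minus_mult) simp
    finally show ?thesis
      by (simp only: a_def mult.assoc)
  qed
  interpret sphere: finite_measure "sphere_measure :: 'a measure"
    by (rule finite_measure_sphere_measure)
  have [measurable]: "?I \<in> borel_measurable sphere_measure"
    by (intro borel_measurable_times borel_measurable_power borel_measurable_divide
        borel_measurable_gauge borel_measurable_const borel_measurable_contact D cont_f)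
  have p_meas [measurable]: "p \<epsilon> \<in> borel_measurable sphere_measure" if "\<bar>\<epsilon>\<bar> < \<delta>" for \<epsilon>
    unfolding p_def using shape[OF that] by (rule wulff_shape.borel_measurable_gauge)
  have off: "AE \<xi> in sphere_measure. \<xi> \<in> sphere 0 1 - kinks wgauge"
    using AE_not_in[OF null_sets_kinks_gauge] AE_space[of "sphere_measure :: 'a measure"]
    by eventually_elim auto
  have dct: "integrable sphere_measure (\<lambda>\<xi>. DIM('a) * ?I \<xi>)"
      "(\<lambda>k. (\<integral>\<xi>. ((1 / p (X k) \<xi>) ^ DIM('a) - (1 / wgauge \<xi>) ^ DIM('a)) / X k \<partial>sphere_measure))
        \<longlonglongrightarrow> (\<integral>\<xi>. DIM('a) * ?I \<xi> \<partial>sphere_measure)"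
    if X: "\<And>k. \<bar>X k\<bar> < \<delta> \<and> X k \<noteq> 0" "X \<longlonglongrightarrow> 0" for X
  proof -
    have [measurable]: "p (X k) \<in> borel_measurable sphere_measure" for k
      using X(1) by (intro p_meas) auto
    have 1: "(\<lambda>\<xi>. DIM('a) * ?I \<xi>) \<in> borel_measurable sphere_measure"
      by measurable
    have 2: "(\<lambda>\<xi>. ((1 / p (X k) \<xi>) ^ DIM('a) - (1 / wgauge \<xi>) ^ DIM('a)) / X k)
        \<in> borel_measurable sphere_measure" for k
      by measurable
    have 3: "integrable sphere_measure (\<lambda>\<xi>::'a. B)"
      by simp
    have 4: "AE \<xi> in sphere_measure. (\<lambda>k. ((1 / p (X k) \<xi>) ^ DIM('a) - (1 / wgauge \<xi>) ^ DIM('a)) / X k)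
        \<longlonglongrightarrow> DIM('a) * ?I \<xi>"
      using off by eventually_elim (rule pointwise[OF X])
    have 5: "AE \<xi> in sphere_measure. norm (((1 / p (X k) \<xi>) ^ DIM('a) - (1 / wgauge \<xi>) ^ DIM('a)) / X k) \<le> B" for k
      using off by eventually_elim (use quot_bound X(1) in auto)
    show "integrable sphere_measure (\<lambda>\<xi>. DIM('a) * ?I \<xi>)"
      using integrable_dominated_convergence[OF 1 2 3 4 5] .
    show "(\<lambda>k. (\<integral>\<xi>. ((1 / p (X k) \<xi>) ^ DIM('a) - (1 / wgauge \<xi>) ^ DIM('a)) / X k \<partial>sphere_measure))
        \<longlonglongrightarrow> (\<integral>\<xi>. DIM('a) * ?I \<xi> \<partial>sphere_measure)"
      using integral_dominated_convergence[OF 1 2 3 4 5] .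
  qed
  \<comment> \<open>Dominated convergence along any one admissible null sequence yields
    integrability; the factor \<open>\<delta> / 2\<close> makes it admissible from its first term
    on.\<close>
  have "integrable sphere_measure (\<lambda>\<xi>. DIM('a) * ?I \<xi>)"
  proof (rule dct(1))
    have "(\<lambda>k. \<delta> / 2 * inverse (real (Suc k))) \<longlonglongrightarrow> \<delta> / 2 * 0"
      by (intro tendsto_mult tendsto_const LIMSEQ_inverse_real_of_nat)
    then show "(\<lambda>k. \<delta> / 2 * inverse (real (Suc k))) \<longlonglongrightarrow> 0"
      by simp
    show "\<bar>\<delta> / 2 * inverse (real (Suc k))\<bar> < \<delta> \<and> \<delta> / 2 * inverse (real (Suc k)) \<noteq> 0" for k
      using \<open>\<delta> > 0\<close> by (auto simp: divide_simps abs_mult intro: add_pos_nonneg)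
  qed
  then show "integrable sphere_measure ?I"
    using integrable_mult_right[of "1 / DIM('a)" sphere_measure "\<lambda>\<xi>. DIM('a) * ?I \<xi>"] by simp
  \<comment> \<open>Within the interval every test sequence satisfies the bound by \<delta> at all
    indices, not only eventually.\<close>
  have "((\<lambda>\<epsilon>. (measure lebesgue (wulff \<Omega> (F \<epsilon>)) - measure lebesgue K) / \<epsilon>) \<longlongrightarrow> integral\<^sup>L sphere_measure ?I)
      (at 0 within {-\<delta><..<\<delta>})"
    unfolding tendsto_at_iff_sequentially
  proof (intro allI impI)
    fix X assume "\<forall>k. X k \<in> {-\<delta><..<\<delta>} - {0}" and "X \<longlonglongrightarrow> 0"
    then have X: "\<And>k. \<bar>X k\<bar> < \<delta> \<and> X k \<noteq> 0"
      by (auto simp: abs_less_iff minus_less_iff)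
    have pow_int: "integrable sphere_measure (\<lambda>\<xi>. (1 / q \<xi>) ^ DIM('a))"
      if "q \<in> borel_measurable sphere_measure" and q: "\<And>\<xi>. norm \<xi> = 1 \<Longrightarrow> b \<le> q \<xi>" for q :: "'a \<Rightarrow> real"
    proof (rule sphere.integrable_const_bound[of _ "(1 / b) ^ DIM('a)"])
      show "AE \<xi> in sphere_measure. norm ((1 / q \<xi>) ^ DIM('a)) \<le> (1 / b) ^ DIM('a)"
        using AE_space
      proof eventually_elim
        case (elim \<xi>)
        then have "b \<le> q \<xi>"
          by (intro q) simp
        then show ?case
          using \<open>b > 0\<close> by (auto simp: norm_power intro!: power_mono frac_le)
      qed
    qed (use that(1) in measurable)
    have "measure lebesgue (wulff \<Omega> (F (X k))) = (\<integral>\<xi>. (1 / p (X k) \<xi>) ^ DIM('a) \<partial>sphere_measure) / DIM('a)" for k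
      unfolding p_def using X by (intro wulff_shape.measure_wulff shape) auto
    moreover have "integrable sphere_measure (\<lambda>\<xi>. (1 / p (X k) \<xi>) ^ DIM('a))" for k
      using X[of k] b(2)[of _ "X k"] p_meas[of "X k"] by (intro pow_int) auto
    moreover have "integrable sphere_measure (\<lambda>\<xi>. (1 / wgauge \<xi>) ^ DIM('a))"
      using b(1)[of _ 0] \<open>\<delta> > 0\<close> by (intro pow_int borel_measurable_gauge) auto
    ultimately have eq: "(measure lebesgue (wulff \<Omega> (F (X k))) - measure lebesgue K) / X k =
        (\<integral>\<xi>. ((1 / p (X k) \<xi>) ^ DIM('a) - (1 / wgauge \<xi>) ^ DIM('a)) / X k \<partial>sphere_measure) / DIM('a)" for k
      by (simp add: measure_wulff diff_divide_distrib mult.commute)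
    have "(\<lambda>k. (\<integral>\<xi>. ((1 / p (X k) \<xi>) ^ DIM('a) - (1 / wgauge \<xi>) ^ DIM('a)) / X k \<partial>sphere_measure) / DIM('a))
        \<longlonglongrightarrow> (\<integral>\<xi>. DIM('a) * ?I \<xi> \<partial>sphere_measure) / DIM('a)"
      using dct(2)[OF X \<open>X \<longlonglongrightarrow> 0\<close>] by (intro tendsto_divide tendsto_const) auto
    also have "(\<integral>\<xi>. DIM('a) * ?I \<xi> \<partial>sphere_measure) / DIM('a) = integral\<^sup>L sphere_measure ?I"
      unfolding integral_mult_right_zero by simp
    finally show "((\<lambda>\<epsilon>. (measure lebesgue (wulff \<Omega> (F \<epsilon>)) - measure lebesgue K) / \<epsilon>) \<circ> X)
        \<longlonglongrightarrow> integral\<^sup>L sphere_measure ?I"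
      by (simp add: o_def eq)
  qed
  then show "((\<lambda>\<epsilon>. (measure lebesgue (wulff \<Omega> (F \<epsilon>)) - measure lebesgue K) / \<epsilon>) \<longlongrightarrow> integral\<^sup>L sphere_measure ?I) (at 0)"
    using \<open>\<delta> > 0\<close> by (subst (asm) at_within_open) auto
qed

subsection \<open>The perturbation defined by Psi\<close>

text \<open>On a compact window around the graph of \<open>f\<close> the derivative of
  \<open>Psi\<close> in t has a positive lower bound \<open>c\<close>, so differences of arguments
  are bounded by \<open>1 / c\<close> times differences of values. Existence, continuity and the
  rate of \<open>f_eps\<close> all come from this.\<close>

lemma f_eps_uniform_variation:
  assumes Psi: "class_CI Psi" and g: "continuous_on \<Omega> g"
  shows "uniform_variation (f_eps Psi f g) (\<lambda>z. g z / deriv (Psi z) (f z))"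
proof -
  have Psi_cont: "continuous_on (sphere 0 1 \<times> {0<..}) (\<lambda>(\<xi>, t). Psi \<xi> t)"
    and der_cont: "continuous_on (sphere 0 1 \<times> {0<..}) (\<lambda>(\<xi>, t). deriv (Psi \<xi>) t)"
    and DERIV: "\<And>z t. z \<in> \<Omega> \<Longrightarrow> 0 < t \<Longrightarrow> DERIV (Psi z) t :> deriv (Psi z) t"
    and der_pos: "\<And>z t. z \<in> \<Omega> \<Longrightarrow> 0 < t \<Longrightarrow> deriv (Psi z) t > 0"
    using Psi \<Omega>_sphere unfolding class_CI_def class_C_def DERIV_deriv_iff_real_differentiable by auto
  have mvt: "\<exists>\<theta>. s < \<theta> \<and> \<theta> < t \<and> Psi z t - Psi z s = (t - s) * deriv (Psi z) \<theta>"
    if "z \<in> \<Omega>" "0 < s" "s < t" for z s t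
    using MVT2[OF that(3), of "Psi z" "deriv (Psi z)"] DERIV[OF that(1)] that(2) by fastforce
  have mono: "Psi z s < Psi z t" if zst: "z \<in> \<Omega>" "0 < s" "s < t" for z s t
  proof -
    obtain \<theta> where "s < \<theta>" "Psi z t - Psi z s = (t - s) * deriv (Psi z) \<theta>"
      using mvt[OF zst] by blast
    moreover have "(t - s) * deriv (Psi z) \<theta> > 0"
      using zst \<open>s < \<theta>\<close> by (intro mult_pos_pos der_pos) auto
    ultimately show ?thesis
      by linarith
  qed
  obtain z0 where z0: "z0 \<in> \<Omega>" "\<And>z. z \<in> \<Omega> \<Longrightarrow> f z0 \<le> f z"
    using continuous_attains_inf[OF compact_\<Omega> \<Omega>_nonempty cont_f] by blast
  obtain z1 where z1: "z1 \<in> \<Omega>" "\<And>z. z \<in> \<Omega> \<Longrightarrow> f z \<le> f z1"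
    using continuous_attains_sup[OF compact_\<Omega> \<Omega>_nonempty cont_f] by blast
  obtain z2 where z2: "z2 \<in> \<Omega>" "\<And>z. z \<in> \<Omega> \<Longrightarrow> \<bar>g z\<bar> \<le> \<bar>g z2\<bar>"
    using continuous_attains_sup[OF compact_\<Omega> \<Omega>_nonempty, of "\<lambda>z. \<bar>g z\<bar>"] g
    by (auto intro: continuous_intros)
  \<comment> \<open>Half the minimum of \<open>f\<close>: the interval of radius \<open>m\<close>
    around each \<open>f z\<close> then stays within \<open>{m..M}\<close>, away from 0.\<close>
  define m where "m = f z0 / 2"
  define M where "M = f z1 + m"
  define G where "G = \<bar>g z2\<bar>"
  have "m > 0"
    using f_pos[OF z0(1)] by (simp add: m_def)
  have window: "m \<le> f z - m" "f z + m \<le> M" if "z \<in> \<Omega>" for z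
    using z0(2)[OF that] z1(2)[OF that] by (auto simp: m_def M_def)
  have "m \<le> M"
    using window[OF z0(1)] \<open>m > 0\<close> by linarith
  have "compact (\<Omega> \<times> {m..M})" "\<Omega> \<times> {m..M} \<noteq> {}"
    using compact_\<Omega> \<Omega>_nonempty \<open>m \<le> M\<close> by (auto intro: compact_Times)
  moreover have "continuous_on (\<Omega> \<times> {m..M}) (\<lambda>(\<xi>, t). deriv (Psi \<xi>) t)"
    using \<open>m > 0\<close> \<Omega>_sphere by (intro continuous_on_subset[OF der_cont]) auto
  ultimately obtain u where u: "u \<in> \<Omega> \<times> {m..M}"
      "\<And>v. v \<in> \<Omega> \<times> {m..M} \<Longrightarrow> (\<lambda>(\<xi>, t). deriv (Psi \<xi>) t) u \<le> (\<lambda>(\<xi>, t). deriv (Psi \<xi>) t) v"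
    using continuous_attains_inf[of "\<Omega> \<times> {m..M}" "\<lambda>(\<xi>, t). deriv (Psi \<xi>) t"] by blast
  define c where "c = deriv (Psi (fst u)) (snd u)"
  have "c > 0"
    unfolding c_def using u(1) \<open>m > 0\<close> by (intro der_pos) auto
  have c_le: "c \<le> deriv (Psi z) t" if "z \<in> \<Omega>" "m \<le> t" "t \<le> M" for z t
    using u(2)[of "(z, t)"] that by (simp add: c_def case_prod_beta)
  have expand: "c * \<bar>t - s\<bar> \<le> \<bar>Psi z t - Psi z s\<bar>" if z: "z \<in> \<Omega>" and st: "m \<le> s" "s \<le> M" "m \<le> t" "t \<le> M" for z s t
  proof -
    have *: "c * (t - s) \<le> Psi z t - Psi z s" if "m \<le> s" "s < t" "t \<le> M" for s t
    proof -
      have "0 < s"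
        using that \<open>m > 0\<close> by linarith
      obtain \<theta> where \<theta>: "s < \<theta>" "\<theta> < t" "Psi z t - Psi z s = (t - s) * deriv (Psi z) \<theta>"
        using mvt[OF z \<open>0 < s\<close> \<open>s < t\<close>] by blast
      have "(t - s) * c \<le> (t - s) * deriv (Psi z) \<theta>"
        using \<theta> that by (intro mult_left_mono c_le z) auto
      with \<theta> show ?thesis
        by (simp add: mult.commute)
    qed
    show ?thesis
      using *[of s t] *[of t s] st by (cases s t rule: linorder_cases) auto
  qed
  \<comment> \<open>A step of length \<open>m\<close> changes \<open>Psi z\<close> by at least
    \<open>c * m\<close>, which must exceed the perturbation \<open>\<epsilon> * g z\<close>. The
    summand 1 covers \<open>G = 0\<close>.\<close>
  define \<delta> where "\<delta> = c * m / (G + 1)"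
  have "G \<ge> 0"
    by (simp add: G_def)
  have "\<delta> > 0"
    using \<open>c > 0\<close> \<open>m > 0\<close> \<open>G \<ge> 0\<close> by (simp add: \<delta>_def)
  define F where "F = f_eps Psi f g"
  have F: "m \<le> F \<epsilon> z \<and> F \<epsilon> z \<le> M \<and> Psi z (F \<epsilon> z) = Psi z (f z) + \<epsilon> * g z"
    if \<epsilon>: "\<bar>\<epsilon>\<bar> < \<delta>" and z: "z \<in> \<Omega>" for \<epsilon> z
  proof -
    have fz: "m \<le> f z - m" "f z + m \<le> M"
      using window[OF z] by auto
    have "\<bar>\<epsilon> * g z\<bar> \<le> \<delta> * (G + 1)"
      using \<epsilon> z2(2)[OF z] by (auto simp: abs_mult G_def intro!: mult_mono)
    then have small: "\<bar>\<epsilon> * g z\<bar> \<le> c * m"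
      using \<open>G \<ge> 0\<close> by (simp add: \<delta>_def)
    have "c * m \<le> \<bar>Psi z (f z + m) - Psi z (f z)\<bar>"
      using expand[OF z, of "f z" "f z + m"] fz \<open>m > 0\<close> by auto
    then have hi: "Psi z (f z) + \<epsilon> * g z \<le> Psi z (f z + m)"
      using mono[OF z, of "f z" "f z + m"] f_pos[OF z] \<open>m > 0\<close> small by auto
    have "c * m \<le> \<bar>Psi z (f z) - Psi z (f z - m)\<bar>"
      using expand[OF z, of "f z - m" "f z"] fz \<open>m > 0\<close> by auto
    then have lo: "Psi z (f z - m) \<le> Psi z (f z) + \<epsilon> * g z"
      using mono[OF z, of "f z - m" "f z"] fz \<open>m > 0\<close> small by auto
    have "\<exists>s\<ge>f z - m. s \<le> f z + m \<and> Psi z s = Psi z (f z) + \<epsilon> * g z"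
      using lo hi
    proof (rule IVT)
      show "\<forall>x. f z - m \<le> x \<and> x \<le> f z + m \<longrightarrow> isCont (Psi z) x"
        using DERIV[OF z] DERIV_isCont fz \<open>m > 0\<close> by (meson less_le_trans)
    qed (use \<open>m > 0\<close> in auto)
    then obtain s where s: "f z - m \<le> s" "s \<le> f z + m" "Psi z s = Psi z (f z) + \<epsilon> * g z"
      by blast
    have "0 < s"
      using s(1) fz \<open>m > 0\<close> by linarith
    have "F \<epsilon> z = s"
      unfolding F_def f_eps_def
    proof (rule the_equality)
      fix t assume t: "0 < t \<and> Psi z t = Psi z (f z) + \<epsilon> * g z"
      then show "t = s"
        using mono[OF z, of s t] mono[OF z, of t s] s(3) \<open>0 < s\<close>
        by (cases s t rule: linorder_cases) auto
    qed (use s \<open>0 < s\<close> in auto)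
    then show ?thesis
      using s fz by auto
  qed
  have f_window: "m \<le> f z" "f z \<le> M" if "z \<in> \<Omega>" for z
    using window[OF that] \<open>m > 0\<close> by auto
  have F_diff: "\<bar>F \<epsilon> z - f z\<bar> \<le> G / c * \<bar>\<epsilon>\<bar>" if \<epsilon>: "\<bar>\<epsilon>\<bar> < \<delta>" and z: "z \<in> \<Omega>" for \<epsilon> z
  proof -
    have "c * \<bar>F \<epsilon> z - f z\<bar> \<le> \<bar>\<epsilon> * g z\<bar>"
      using expand[OF z, of "f z" "F \<epsilon> z"] F[OF \<epsilon> z] f_window[OF z] by auto
    also have "\<dots> \<le> \<bar>\<epsilon>\<bar> * G"
      using z2(2)[OF z] by (auto simp: abs_mult G_def intro!: mult_left_mono)
    finally show ?thesis
      using \<open>c > 0\<close> by (simp add: field_simps)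
  qed
  have Psi_lim: "(\<lambda>k. Psi (z k) (s k)) \<longlonglongrightarrow> Psi a t"
    and der_lim: "(\<lambda>k. deriv (Psi (z k)) (s k)) \<longlonglongrightarrow> deriv (Psi a) t"
    if "\<And>k. z k \<in> \<Omega> \<and> s k > 0" "z \<longlonglongrightarrow> a" "s \<longlonglongrightarrow> t" "a \<in> \<Omega>" "t > 0" for z s a t
  proof -
    have "(z k, s k) \<in> sphere 0 1 \<times> {0<..}" for k
      using that(1)[of k] \<Omega>_sphere by auto
    then have *: "(\<lambda>k. (z k, s k)) \<longlonglongrightarrow> (a, t)" "(a, t) \<in> sphere 0 1 \<times> {0<..}"
        "\<forall>\<^sub>F k in sequentially. (z k, s k) \<in> sphere 0 1 \<times> {0<..}"
      using that \<Omega>_sphere by (auto intro!: tendsto_Pair always_eventually)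
    show "(\<lambda>k. Psi (z k) (s k)) \<longlonglongrightarrow> Psi a t"
      using continuous_on_tendsto_compose[OF Psi_cont *] by simp
    show "(\<lambda>k. deriv (Psi (z k)) (s k)) \<longlonglongrightarrow> deriv (Psi a) t"
      using continuous_on_tendsto_compose[OF der_cont *] by simp
  qed
  have f_lim: "(\<lambda>k. f (z k)) \<longlonglongrightarrow> f a" and g_lim: "(\<lambda>k. g (z k)) \<longlonglongrightarrow> g a"
    if "\<And>k. z k \<in> \<Omega>" "z \<longlonglongrightarrow> a" "a \<in> \<Omega>" for z a
    using that by (auto intro!: continuous_on_tendsto_compose[OF cont_f] continuous_on_tendsto_compose[OF g])
  have cont: "continuous_on \<Omega> (F \<epsilon>)" if \<epsilon>: "\<bar>\<epsilon>\<bar> < \<delta>" for \<epsilon>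
    unfolding continuous_on_sequentially
  proof (intro ballI allI impI, elim conjE)
    fix z a assume z: "\<forall>k. z k \<in> \<Omega>" "z \<longlonglongrightarrow> a" and a: "a \<in> \<Omega>"
    have Fa: "F \<epsilon> a > 0"
      using F[OF \<epsilon> a] \<open>m > 0\<close> by linarith
    \<comment> \<open>Both arguments are compared under the same \<open>Psi (z k)\<close>: its value
      at \<open>F \<epsilon> (z k)\<close> is known from the defining equation, and
      \<open>F \<epsilon> a\<close> is fixed.\<close>
    have "(\<lambda>k. 1 / c * \<bar>Psi (z k) (f (z k)) + \<epsilon> * g (z k) - Psi (z k) (F \<epsilon> a)\<bar>) \<longlonglongrightarrow>
        1 / c * \<bar>Psi a (f a) + \<epsilon> * g a - Psi a (F \<epsilon> a)\<bar>"
      using z a f_pos Fa by (intro tendsto_intros Psi_lim f_lim g_lim) auto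
    then have "(\<lambda>k. 1 / c * \<bar>Psi (z k) (f (z k)) + \<epsilon> * g (z k) - Psi (z k) (F \<epsilon> a)\<bar>) \<longlonglongrightarrow> 0"
      using F[OF \<epsilon> a] by simp
    moreover have "norm (F \<epsilon> (z k) - F \<epsilon> a) \<le> 1 / c * \<bar>Psi (z k) (f (z k)) + \<epsilon> * g (z k) - Psi (z k) (F \<epsilon> a)\<bar>" for k
      using expand[of "z k" "F \<epsilon> a" "F \<epsilon> (z k)"] F[OF \<epsilon>, of "z k"] F[OF \<epsilon> a] z(1) \<open>c > 0\<close>
      by (simp add: field_simps)
    ultimately have "(\<lambda>k. F \<epsilon> (z k) - F \<epsilon> a) \<longlonglongrightarrow> 0"
      by (rule Lim_null_comparison[OF always_eventually[OF allI], rotated])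
    then show "(F \<epsilon> \<circ> z) \<longlonglongrightarrow> F \<epsilon> a"
      by (simp add: o_def LIM_zero_cancel)
  qed
  have quot: "(\<lambda>k. (F (X k) (z k) - f (z k)) / X k) \<longlonglongrightarrow> g a / deriv (Psi a) (f a)"
    if X: "\<And>k. \<bar>X k\<bar> < \<delta> \<and> X k \<noteq> 0 \<and> z k \<in> \<Omega>" "X \<longlonglongrightarrow> 0" "z \<longlonglongrightarrow> a" "a \<in> \<Omega>" for X z a
  proof -
    \<comment> \<open>The mean value theorem expresses \<open>X k * g (z k)\<close> through the
      derivative at an intermediate point, which is squeezed to \<open>f a\<close>. If
      \<open>F (X k) (z k) = f (z k)\<close>, both sides vanish.\<close>
    have "\<exists>\<theta>. \<theta> > 0 \<and> \<bar>\<theta> - f (z k)\<bar> \<le> \<bar>F (X k) (z k) - f (z k)\<bar> \<and>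
        X k * g (z k) = (F (X k) (z k) - f (z k)) * deriv (Psi (z k)) \<theta>" for k
    proof -
      have zk: "z k \<in> \<Omega>" and Xk: "\<bar>X k\<bar> < \<delta>"
        using X(1) by auto
      let ?s = "F (X k) (z k)" and ?t = "f (z k)"
      have s: "0 < ?s" "Psi (z k) ?s = Psi (z k) ?t + X k * g (z k)" and t: "0 < ?t"
        using F[OF Xk zk] f_pos[OF zk] \<open>m > 0\<close> by auto
      consider "?s < ?t" | "?s = ?t" | "?t < ?s"
        by linarith
      then show ?thesis
      proof cases
        case 1
        obtain \<theta> where "?s < \<theta>" "\<theta> < ?t" "Psi (z k) ?t - Psi (z k) ?s = (?t - ?s) * deriv (Psi (z k)) \<theta>"
          using mvt[OF zk s(1) 1] by blast
        with s show ?thesis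
          by (intro exI[of _ \<theta>]) (auto simp: algebra_simps)
      next
        case 2
        with s t show ?thesis
          by (intro exI[of _ ?t]) auto
      next
        case 3
        obtain \<theta> where "?t < \<theta>" "\<theta> < ?s" "Psi (z k) ?s - Psi (z k) ?t = (?s - ?t) * deriv (Psi (z k)) \<theta>"
          using mvt[OF zk t 3] by blast
        with s t show ?thesis
          by (intro exI[of _ \<theta>]) (auto simp: algebra_simps)
      qed
    qed
    then obtain \<theta> where \<theta>: "\<And>k. \<theta> k > 0" "\<And>k. \<bar>\<theta> k - f (z k)\<bar> \<le> \<bar>F (X k) (z k) - f (z k)\<bar>"
        "\<And>k. X k * g (z k) = (F (X k) (z k) - f (z k)) * deriv (Psi (z k)) (\<theta> k)"
      by metis
    have "(\<lambda>k. G / c * \<bar>X k\<bar>) \<longlonglongrightarrow> 0"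
      using tendsto_mult[OF tendsto_const tendsto_rabs[OF X(2)], of "G / c"] by simp
    moreover have "norm (\<theta> k - f (z k)) \<le> G / c * \<bar>X k\<bar>" for k
      using \<theta>(2)[of k] F_diff[of "X k" "z k"] X(1)[of k] by simp
    ultimately have "(\<lambda>k. \<theta> k - f (z k)) \<longlonglongrightarrow> 0"
      by (rule Lim_null_comparison[OF always_eventually[OF allI], rotated])
    moreover have "(\<lambda>k. f (z k)) \<longlonglongrightarrow> f a"
      using X by (intro f_lim) auto
    ultimately have "(\<lambda>k. (\<theta> k - f (z k)) + f (z k)) \<longlonglongrightarrow> 0 + f a"
      by (rule tendsto_add)
    then have \<theta>_lim: "\<theta> \<longlonglongrightarrow> f a"
      by simp
    have "(\<lambda>k. g (z k) / deriv (Psi (z k)) (\<theta> k)) \<longlonglongrightarrow> g a / deriv (Psi a) (f a)"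
      using X \<theta>(1) \<theta>_lim f_pos der_pos[of a "f a"] by (intro tendsto_divide g_lim der_lim) auto
    moreover have "g (z k) / deriv (Psi (z k)) (\<theta> k) = (F (X k) (z k) - f (z k)) / X k" for k
      using \<theta>(3)[of k] X(1)[of k] der_pos[of "z k" "\<theta> k"] \<theta>(1)[of k] by (simp add: field_simps)
    ultimately show ?thesis
      by simp
  qed
  show ?thesis
    unfolding uniform_variation_def F_def[symmetric]
  proof (rule exI[of _ \<delta>], rule conjI[OF \<open>\<delta> > 0\<close>], rule exI[of _ m], rule conjI[OF \<open>m > 0\<close>],
      rule exI[of _ M], rule exI[of _ "G / c"], intro conjI)
    show "\<forall>\<epsilon>. \<bar>\<epsilon>\<bar> < \<delta> \<longrightarrow> continuous_on \<Omega> (F \<epsilon>)"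
      using cont by blast
    show "\<forall>\<epsilon>. \<forall>z\<in>\<Omega>. \<bar>\<epsilon>\<bar> < \<delta> \<longrightarrow> m \<le> F \<epsilon> z \<and> F \<epsilon> z \<le> M \<and> \<bar>F \<epsilon> z - f z\<bar> \<le> G / c * \<bar>\<epsilon>\<bar>"
      using F F_diff by blast
    show "\<forall>X z a. (\<forall>k. \<bar>X k\<bar> < \<delta> \<and> X k \<noteq> 0 \<and> z k \<in> \<Omega>) \<longrightarrow> X \<longlonglongrightarrow> 0 \<longrightarrow> z \<longlonglongrightarrow> a \<longrightarrow> a \<in> \<Omega> \<longrightarrow>
       (\<lambda>k. (F (X k) (z k) - f (z k)) / X k) \<longlonglongrightarrow> g a / deriv (Psi a) (f a)"
      using quot by blast
  qed
qed

end

section \<open>Decreasing Psi and the assembly of the formula\<close>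

lemma deriv_minus:
  fixes h :: "real \<Rightarrow> real"
  assumes "h differentiable (at t)"
  shows "deriv (\<lambda>t. - h t) t = - deriv h t"
  using assms by (intro DERIV_imp_deriv DERIV_minus) (simp add: DERIV_deriv_iff_real_differentiable)

lemma class_CI_minus:
  fixes Psi :: "'a::euclidean_space \<Rightarrow> real \<Rightarrow> real"
  assumes "class_Cd Psi"
  shows "class_CI (\<lambda>\<xi> t. - Psi \<xi> t)"
proof -
  have C: "continuous_on (sphere 0 1 \<times> {0<..}) (\<lambda>(\<xi>, t). Psi \<xi> t)"
    "continuous_on (sphere 0 1 \<times> {0<..}) (\<lambda>(\<xi>, t). deriv (Psi \<xi>) t)"
    and diff: "\<And>\<xi> t. \<xi> \<in> sphere 0 1 \<Longrightarrow> 0 < t \<Longrightarrow> Psi \<xi> differentiable (at t)"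
    and neg: "\<And>\<xi> t. \<xi> \<in> sphere 0 1 \<Longrightarrow> 0 < t \<Longrightarrow> deriv (Psi \<xi>) t < 0"
    using assms unfolding class_Cd_def class_C_def by auto
  have "continuous_on (sphere 0 1 \<times> {0<..}) (\<lambda>(\<xi>, t). - Psi \<xi> t)"
    using continuous_on_minus[OF C(1)] by (simp add: case_prod_beta)
  moreover have "continuous_on (sphere 0 1 \<times> {0<..}) (\<lambda>(\<xi>, t). deriv (\<lambda>t. - Psi \<xi> t) t)"
  proof (rule continuous_on_eq[OF continuous_on_minus[OF C(2)]])
    fix u :: "'a \<times> real" assume "u \<in> sphere 0 1 \<times> {0<..}"
    then show "- (case u of (\<xi>, t) \<Rightarrow> deriv (Psi \<xi>) t) = (case u of (\<xi>, t) \<Rightarrow> deriv (\<lambda>t. - Psi \<xi> t) t)"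
      using diff by (auto simp: deriv_minus)
  qed
  moreover have "(\<lambda>t. - Psi \<xi> t) differentiable (at t)" if "\<xi> \<in> sphere 0 1" "0 < t" for \<xi> t
    using diff[OF that] by (rule differentiable_minus)
  ultimately show ?thesis
    unfolding class_CI_def class_C_def using diff neg by (auto simp: deriv_minus)
qed

theorem theorem4p4:
  fixes Psi :: "'a::euclidean_space \<Rightarrow> real \<Rightarrow> real"
    and \<Omega> :: "'a set" and f g :: "'a \<Rightarrow> real"
  assumes "DIM('a) \<ge> 2"
    and "class_CI Psi \<or> class_Cd Psi"
    and "closed \<Omega>" and "\<Omega> \<subseteq> sphere 0 1"
    and "\<not> (\<exists>v\<in>sphere 0 1. \<forall>\<xi>\<in>\<Omega>. \<xi> \<bullet> v \<ge> 0)"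
    and "continuous_on \<Omega> f" and "\<forall>\<xi>\<in>\<Omega>. f \<xi> > 0"
    and "continuous_on \<Omega> g"
  shows "((\<lambda>\<epsilon>. (measure lebesgue (wulff \<Omega> (f_eps Psi f g \<epsilon>)) - measure lebesgue (wulff \<Omega> f)) / \<epsilon>)
           \<longlongrightarrow> MO_integral Psi (wulff \<Omega> f) \<Omega> g) (at 0)"
proof -
  have "\<exists>\<xi>\<in>\<Omega>. \<xi> \<bullet> v > 0" if "v \<in> sphere 0 1" for v
  proof -
    have "- v \<in> sphere 0 1"
      using that by simp
    then have "\<not> (\<forall>\<xi>\<in>\<Omega>. \<xi> \<bullet> (- v) \<ge> 0)"
      using assms(5) by blast
    then show ?thesis
      by (auto simp: not_le)
  qed
  then interpret wulff_shape \<Omega> f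
    using assms by unfold_locales auto
  have C: "class_C Psi"
    using assms(2) unfolding class_CI_def class_Cd_def by blast
  have diff: "Psi z differentiable (at (f z))" and der_neq_0: "deriv (Psi z) (f z) \<noteq> 0" if z: "z \<in> \<Omega>" for z
  proof -
    have z': "z \<in> sphere 0 1" "f z > 0"
      using z \<Omega>_sphere f_pos by auto
    then show "Psi z differentiable (at (f z))"
      using C unfolding class_C_def by blast
    show "deriv (Psi z) (f z) \<noteq> 0"
      using assms(2) z' unfolding class_CI_def class_Cd_def by (metis less_irrefl)
  qed
  have var: "uniform_variation (f_eps Psi f g) (\<lambda>z. g z / deriv (Psi z) (f z))"
    using assms(2)
  proof
    assume "class_CI Psi"
    then show ?thesis
      using assms(8) by (rule f_eps_uniform_variation)
  next
    assume "class_Cd Psi"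
    have "uniform_variation (f_eps (\<lambda>\<xi> t. - Psi \<xi> t) f (\<lambda>z. - g z)) (\<lambda>z. - g z / deriv (\<lambda>t. - Psi z t) (f z))"
      using class_CI_minus[OF \<open>class_Cd Psi\<close>] assms(8)
      by (intro f_eps_uniform_variation continuous_on_minus)
    moreover have "f_eps (\<lambda>\<xi> t. - Psi \<xi> t) f (\<lambda>z. - g z) = f_eps Psi f g"
    proof -
      have "- Psi z s = - Psi z (f z) + \<epsilon> * - g z \<longleftrightarrow> Psi z s = Psi z (f z) + \<epsilon> * g z" for \<epsilon> z s
        by auto
      then show ?thesis
        by (intro ext) (simp add: f_eps_def)
    qed
    \<comment> \<open>Agreement on \<Omega> suffices, since \<open>uniform_variation\<close> reads
      the derivative only there.\<close>
    moreover have "- g z / deriv (\<lambda>t. - Psi z t) (f z) = g z / deriv (Psi z) (f z)" if "z \<in> \<Omega>" for z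
      using diff[OF that] by (simp add: deriv_minus)
    ultimately show ?thesis
      unfolding uniform_variation_def by simp
  qed
  have der: "continuous_on \<Omega> (\<lambda>z. deriv (Psi z) (f z))"
  proof -
    have "continuous_on (sphere 0 1 \<times> {0<..}) (\<lambda>(\<xi>, t). deriv (Psi \<xi>) t)"
      using C unfolding class_C_def by blast
    then have "continuous_on \<Omega> (\<lambda>z. (\<lambda>(\<xi>, t). deriv (Psi \<xi>) t) (z, f z))"
      by (rule continuous_on_compose2) (use \<Omega>_sphere f_pos cont_f in \<open>auto intro!: continuous_intros\<close>)
    then show ?thesis
      by simp
  qed
  then have "continuous_on \<Omega> (\<lambda>z. g z / deriv (Psi z) (f z))"
    using der_neq_0 assms(8) by (intro continuous_on_divide) auto
  note variation = wulff_volume_variation[OF var this]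
  \<comment> \<open>A measurable representative of \<open>MO_density\<close>: off the kinks the
    radial function is \<open>1 / wgauge\<close>, the normal is \<open>contact\<close>, and the
    support function at the normal is \<open>f\<close>.\<close>
  define D where "D \<xi> = (1 / wgauge \<xi>) ^ DIM('a) / (f (contact \<xi>) * deriv (Psi (contact \<xi>)) (f (contact \<xi>)))" for \<xi>
  have eq: "(1 / wgauge \<xi>) ^ DIM('a) * (g (contact \<xi>) / deriv (Psi (contact \<xi>)) (f (contact \<xi>)) / f (contact \<xi>)) =
      D \<xi> * g (contact \<xi>)" for \<xi>
    by (simp add: D_def)
  have "MO_integral Psi K \<Omega> g = (\<integral>\<xi>. D \<xi> * g (contact \<xi>) \<partial>sphere_measure)"
  proof (rule MO_integral_eq[OF _ _ null_sets_kinks_gauge])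
    have "contact \<in> borel_measurable sphere_measure"
      using measurable_contact by (simp add: measurable_restrict_space2_iff)
    then show "contact \<in> measurable sphere_measure (restrict_space borel (sphere 0 1))"
      using contact_in \<Omega>_sphere by (intro measurable_restrict_space2) auto
    show "D \<in> borel_measurable sphere_measure"
      unfolding D_def
      by (intro borel_measurable_times borel_measurable_power borel_measurable_divide
          borel_measurable_gauge borel_measurable_const borel_measurable_contact cont_f der)
  next
    fix \<xi> assume \<xi>: "\<xi> \<in> sphere 0 1 - kinks wgauge \<inter> sphere 0 1"
    then have \<xi>': "\<xi> \<in> sphere 0 1 - kinks wgauge" "\<xi> \<noteq> 0" "\<xi> \<notin> kinks wgauge"
      by auto
    note max = contact_in contact_eq(2)[OF \<xi>'(1)]
    have "MO_density Psi K \<xi> = D \<xi>"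
      using radial_fun_wulff[OF \<xi>'(2)] supp_fun_maximizer[OF \<xi>'(2) max]
      by (simp add: MO_density_def D_def flip: contact_eq(1)[OF \<xi>'(1)])
    then show "normals_at K \<xi> = {contact \<xi>} \<and> MO_density Psi K \<xi> = D \<xi>"
      using normals_at_wulff[OF \<xi>'(2,3) max] by blast
  next
    show "integrable sphere_measure (\<lambda>\<xi>. D \<xi> * g (contact \<xi>))"
      using variation(1) unfolding eq .
  qed (use assms contact_in in auto)
  with variation(2) show ?thesis
    by (simp only: eq)
qed

end
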